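(* Let $Q$ be a commutative unital quantale. The full subcategory $Q\text{-}\mathbf{Sup}_{\mathrm{ccd}}$ of $Q\text{-}\mathbf{Sup}$ consisting of the constructively completely distributive $Q$-categories is closed under the tensor product $\otimes$ and under the exponential objects $\mathbb{B}^{\mathbb{A}}$ (internal homs) of $Q\text{-}\mathbf{Sup}$. Hence $(Q\text{-}\mathbf{Sup}_{\mathrm{ccd}},\otimes,\mathbb{Q})$ is a symmetric monoidal closed category.
   Context: A commutative unital quantale $Q$ is a complete lattice with a commutative associative operation $\&$ with unit $\mathrm{k}$ distributing over arbitrary joins in each variable; $a\to(-)$ is the right adjoint of $a\&(-)$. A $Q$-category $\mathbb{A}$ is a set $\mathbb{A}_0$ with $\mathbb{A}\colon\mathbb{A}_0\times\mathbb{A}_0\to Q$ such that $\mathrm{k}\le\mathbb{A}(x,x)$ and $\mathbb{A}(y,z)\&\mathbb{A}(x,y)\le\mathbb{A}(x,z)$; its underlying preorder is $x\le y\iff\mathrm{k}\le\mathbb{A}(x,y)$, and $\mathbb{A}$ is skeletal if this is a partial order. A $Q$-functor is a map $F$ with $\mathbb{A}(x,y)\le\mathbb{B}(Fx,Fy)$; $F\dashv G$ means $\mathbb{B}(Fx,y)=\mathbb{A}(x,Gy)$. The presheaf $Q$-category $\mathcal{P}\mathbb{A}$ consists of maps $\lambda\colon\mathbb{A}_0\to Q$ with $\lambda(y)\&\mathbb{A}(x,y)\le\lambda(x)$, with $\mathcal{P}\mathbb{A}(\lambda,\mu)=\bigwedge_x\lambda(x)\to\mu(x)$; the Yoneda embedding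 is $Y_{\mathbb{A}}(x)=\mathbb{A}(-,x)$. $\mathbb{A}$ is cocomplete if $Y_{\mathbb{A}}$ has a left adjoint $S_{\mathbb{A}}$, and constructively completely distributive (ccd) if moreover $S_{\mathbb{A}}$ has a left adjoint, i.e. there is a chain $T_{\mathbb{A}}\dashv S_{\mathbb{A}}\dashv Y_{\mathbb{A}}\colon\mathbb{A}\to\mathcal{P}\mathbb{A}$. $Q\text{-}\mathbf{Sup}$ is the category of skeletal cocomplete $Q$-categories and left adjoint $Q$-functors. Its objects correspond to $Q$-modules, i.e. complete lattices with an action $q\cdot x$ of the monoid $(Q,\&,\mathrm{k})$ preserving joins in each variable, via $\mathbb{A}(x,y)=\bigvee\{q\in Q\mid q\cdot x\le y\}$; morphisms correspond to maps preserving joins and the action. A bimorphism $\mathbb{A}\times\mathbb{B}\to\mathbb{C}$ is a map that is a $Q\text{-}\mathbf{Sup}$-morphism in each variable separately; $\mathbb{A}\otimes\mathbb{B}$ represents bimorphisms out of $\mathbb{A}\times\mathbb{B}$. $Q\text{-}\mathbf{Sup}$ is symmetric monoidal closed with this tensor product, with unit $\mathbb{Q}$ (underlying set $Q$, hom $\mathbb{Q}(p,q)=p\to q$), and with internal hom $\mathbb{B}^{\mathbb{A}}=Q\text{-}\mathbf{Sup}(\mathbb{A},\mathbb{B})$ having pointwise joins and hom $(F,G)\mapsto\bigwedge_{x}\mathbb{B}(Fx,Gx)$. *)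

theory Defs
  imports "HOL-Library.FuncSet"
begin

section \<open>Commutative unital quantales\<close>

text \<open>The quantale is a type: its multiplication is \<open>*\<close> and its unit \<open>k\<close> is \<open>1\<close>.  The unit need
  not be the top element, and the one-element quantale is allowed.\<close>

class comm_unital_quantale = complete_lattice + comm_monoid_mult +
  assumes mult_Sup: "a * Sup B = Sup ((\<lambda>b. a * b) ` B)"

definition residual :: "'q::comm_unital_quantale \<Rightarrow> 'q \<Rightarrow> 'q"  (infixr "\<leadsto>" 65)
  where "a \<leadsto> b = Sup {q. a * q \<le> b}"

lemma quantale_mult_mono:
  fixes a b c :: "'q::comm_unital_quantale"
  assumes "b \<le> c"
  shows "a * b \<le> a * c"
proof -
  have "Sup {b, c} = c"
    using assms by (simp add: sup.absorb2)
  then have "a * c = Sup ((\<lambda>x. a * x) ` {b, c})"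
    by (metis mult_Sup)
  moreover have "a * b \<le> Sup ((\<lambda>x. a * x) ` {b, c})"
    by (rule Sup_upper) simp
  ultimately show ?thesis by simp
qed

lemma residual_adjoint:
  fixes a b c :: "'q::comm_unital_quantale"
  shows "a * b \<le> c \<longleftrightarrow> b \<le> a \<leadsto> c"
proof
  assume "a * b \<le> c"
  then show "b \<le> a \<leadsto> c"
    unfolding residual_def by (intro Sup_upper) simp
next
  assume "b \<le> a \<leadsto> c"
  then have "a * b \<le> a * Sup {q. a * q \<le> c}"
    unfolding residual_def by (rule quantale_mult_mono)
  also have "\<dots> \<le> c"
    by (subst mult_Sup) (auto intro!: Sup_least)
  finally show "a * b \<le> c" .
qed


section \<open>\<open>Q\<close>-categories, \<open>Q\<close>-functors and adjunctions\<close>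

record ('a, 'q) qcat =
  obj :: "'a set"
  hom :: "'a \<Rightarrow> 'a \<Rightarrow> 'q"

definition is_qcat :: "('a, 'q::comm_unital_quantale) qcat \<Rightarrow> bool" where
  "is_qcat A \<longleftrightarrow>
     (\<forall>x\<in>obj A. 1 \<le> hom A x x) \<and>
     (\<forall>x\<in>obj A. \<forall>y\<in>obj A. \<forall>z\<in>obj A. hom A y z * hom A x y \<le> hom A x z)"

definition qle :: "('a, 'q::comm_unital_quantale) qcat \<Rightarrow> 'a \<Rightarrow> 'a \<Rightarrow> bool" where
  "qle A x y \<longleftrightarrow> 1 \<le> hom A x y"

definition skeletal :: "('a, 'q::comm_unital_quantale) qcat \<Rightarrow> bool" where
  "skeletal A \<longleftrightarrow> (\<forall>x\<in>obj A. \<forall>y\<in>obj A. qle A x y \<and> qle A y x \<longrightarrow> x = y)"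

definition qfunctor ::
    "('a, 'q::comm_unital_quantale) qcat \<Rightarrow> ('b, 'q) qcat \<Rightarrow> ('a \<Rightarrow> 'b) \<Rightarrow> bool" where
  "qfunctor A B F \<longleftrightarrow>
     F \<in> obj A \<rightarrow> obj B \<and> (\<forall>x\<in>obj A. \<forall>y\<in>obj A. hom A x y \<le> hom B (F x) (F y))"

text \<open>\<open>adjoint A B F G\<close> says that \<open>F : A \<rightarrow> B\<close> is left adjoint to \<open>G : B \<rightarrow> A\<close>.\<close>

definition adjoint ::
    "('a, 'q::comm_unital_quantale) qcat \<Rightarrow> ('b, 'q) qcat \<Rightarrow> ('a \<Rightarrow> 'b) \<Rightarrow> ('b \<Rightarrow> 'a) \<Rightarrow> bool" where
  "adjoint A B F G \<longleftrightarrow>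
     qfunctor A B F \<and> qfunctor B A G \<and>
     (\<forall>x\<in>obj A. \<forall>y\<in>obj B. hom B (F x) y = hom A x (G y))"

definition qop :: "('a, 'q) qcat \<Rightarrow> ('a, 'q) qcat" where
  "qop A = \<lparr>obj = obj A, hom = (\<lambda>x y. hom A y x)\<rparr>"

definition Q_cat :: "('q::comm_unital_quantale, 'q) qcat" where
  "Q_cat = \<lparr>obj = UNIV, hom = (\<leadsto>)\<rparr>"


section \<open>Presheaves, cocompleteness and complete distributivity\<close>

text \<open>Maps defined on the objects of a \<open>Q\<close>-category are represented by functions that are
  \<open>undefined\<close> elsewhere (\<^const>\<open>extensional\<close>), so that equality of maps is equality in HOL.\<close>

definition presheaf_cat :: "('a, 'q::comm_unital_quantale) qcat \<Rightarrow> ('a \<Rightarrow> 'q, 'q) qcat" where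
  "presheaf_cat A =
     \<lparr>obj = {\<phi> \<in> extensional (obj A). \<forall>x\<in>obj A. \<forall>y\<in>obj A. \<phi> y * hom A x y \<le> \<phi> x},
      hom = (\<lambda>\<phi> \<psi>. INF x\<in>obj A. \<phi> x \<leadsto> \<psi> x)\<rparr>"

definition yoneda :: "('a, 'q::comm_unital_quantale) qcat \<Rightarrow> 'a \<Rightarrow> ('a \<Rightarrow> 'q)" where
  "yoneda A x = (\<lambda>y\<in>obj A. hom A y x)"

definition cocomplete :: "('a, 'q::comm_unital_quantale) qcat \<Rightarrow> bool" where
  "cocomplete A \<longleftrightarrow> (\<exists>S. adjoint (presheaf_cat A) A S (yoneda A))"

definition ccd :: "('a, 'q::comm_unital_quantale) qcat \<Rightarrow> bool" where
  "ccd A \<longleftrightarrow>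
     (\<exists>S T. adjoint (presheaf_cat A) A S (yoneda A) \<and> adjoint A (presheaf_cat A) T S)"


section \<open>The category \<open>Q-Sup\<close> and its full subcategory of ccd objects\<close>

definition QSup :: "('a, 'q::comm_unital_quantale) qcat \<Rightarrow> bool" where
  "QSup A \<longleftrightarrow> is_qcat A \<and> skeletal A \<and> cocomplete A"

definition QSup_ccd :: "('a, 'q::comm_unital_quantale) qcat \<Rightarrow> bool" where
  "QSup_ccd A \<longleftrightarrow> QSup A \<and> ccd A"

definition left_adjoint ::
    "('a, 'q::comm_unital_quantale) qcat \<Rightarrow> ('b, 'q) qcat \<Rightarrow> ('a \<Rightarrow> 'b) \<Rightarrow> bool" where
  "left_adjoint A B F \<longleftrightarrow> (\<exists>G. adjoint A B F G)"

definition Mor ::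
    "('a, 'q::comm_unital_quantale) qcat \<Rightarrow> ('b, 'q) qcat \<Rightarrow> ('a \<Rightarrow> 'b) set" where
  "Mor A B = {F \<in> extensional (obj A). left_adjoint A B F}"

definition idm :: "('a, 'q) qcat \<Rightarrow> 'a \<Rightarrow> 'a" where
  "idm A = (\<lambda>x\<in>obj A. x)"

text \<open>Composition of \<open>F \<in> Mor A B\<close> with \<open>G \<in> Mor B C\<close> is \<open>mcomp A G F\<close>; the domain \<open>A\<close> has to be
  given, since it cannot be read off from \<open>F\<close>.\<close>

abbreviation mcomp :: "('a, 'q) qcat \<Rightarrow> ('b \<Rightarrow> 'c) \<Rightarrow> ('a \<Rightarrow> 'b) \<Rightarrow> ('a \<Rightarrow> 'c)" where
  "mcomp A G F \<equiv> compose (obj A) G F"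

definition is_iso ::
    "('a, 'q::comm_unital_quantale) qcat \<Rightarrow> ('b, 'q) qcat \<Rightarrow> ('a \<Rightarrow> 'b) \<Rightarrow> bool" where
  "is_iso A B F \<longleftrightarrow> F \<in> Mor A B \<and> (\<exists>G\<in>Mor B A. mcomp A G F = idm A \<and> mcomp B F G = idm B)"

text \<open>The internal hom \<open>B\<^sup>A\<close> is \<open>internal_hom A B\<close>.\<close>

definition internal_hom ::
    "('a, 'q::comm_unital_quantale) qcat \<Rightarrow> ('b, 'q) qcat \<Rightarrow> ('a \<Rightarrow> 'b, 'q) qcat" where
  "internal_hom A B = \<lparr>obj = Mor A B, hom = (\<lambda>F G. INF x\<in>obj A. hom B (F x) (G x))\<rparr>"


section \<open>Bimorphisms and the tensor product\<close>

definition bimorphism ::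
    "('a, 'q::comm_unital_quantale) qcat \<Rightarrow> ('b, 'q) qcat \<Rightarrow> ('c, 'q) qcat \<Rightarrow> ('a \<times> 'b \<Rightarrow> 'c) \<Rightarrow> bool"
  where
  "bimorphism A B C f \<longleftrightarrow>
     (\<forall>a\<in>obj A. left_adjoint B C (\<lambda>b. f (a, b))) \<and>
     (\<forall>b\<in>obj B. left_adjoint A C (\<lambda>a. f (a, b)))"

text \<open>HOL cannot quantify over all types inside a definition, so \<open>A \<otimes> B\<close> is constructed concretely
  instead of being an arbitrary representing object.  Every \<open>C\<close> in \<open>Q-Sup\<close> is isomorphic to the
  opposite of the \<open>Q\<close>-category of morphisms from \<open>C\<close> to the opposite of \<open>Q\<close>; so \<open>A \<otimes> B\<close> has to be
  the opposite of the \<open>Q\<close>-category of bimorphisms from \<open>A \<times> B\<close> to the opposite of \<open>Q\<close>.  As the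
  hom of the latter is \<open>p q \<mapsto> (q \<leadsto> p)\<close>, taking the opposite twice leaves the pointwise hom below.\<close>

definition tensor ::
    "('a, 'q::comm_unital_quantale) qcat \<Rightarrow> ('b, 'q) qcat \<Rightarrow> ('a \<times> 'b \<Rightarrow> 'q, 'q) qcat"
    (infixr "\<otimes>" 70) where
  "A \<otimes> B =
     \<lparr>obj = {\<phi> \<in> extensional (obj A \<times> obj B). bimorphism A B (qop Q_cat) \<phi>},
      hom = (\<lambda>\<phi> \<psi>. INF p\<in>obj A \<times> obj B. \<phi> p \<leadsto> \<psi> p)\<rparr>"

text \<open>The pure tensor \<open>a \<otimes> b\<close> represents evaluation at \<open>(a, b)\<close>: the hom from it to any
  \<open>\<phi>\<close> in \<open>A \<otimes> B\<close> is \<open>\<phi> (a, b)\<close>.\<close>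

definition pure_tensor ::
    "('a, 'q::comm_unital_quantale) qcat \<Rightarrow> ('b, 'q) qcat \<Rightarrow> 'a \<Rightarrow> 'b \<Rightarrow> ('a \<times> 'b \<Rightarrow> 'q)" where
  "pure_tensor A B a b = (\<lambda>p\<in>obj A \<times> obj B. INF \<phi>\<in>obj (A \<otimes> B). \<phi> (a, b) \<leadsto> \<phi> p)"

definition tensor_lift ::
    "('a, 'q::comm_unital_quantale) qcat \<Rightarrow> ('b, 'q) qcat \<Rightarrow> ('c, 'q) qcat \<Rightarrow>
     ('a \<times> 'b \<Rightarrow> 'c) \<Rightarrow> (('a \<times> 'b \<Rightarrow> 'q) \<Rightarrow> 'c)" where
  "tensor_lift A B C f =
     (THE h. h \<in> Mor (A \<otimes> B) C \<and> (\<forall>a\<in>obj A. \<forall>b\<in>obj B. h (pure_tensor A B a b) = f (a, b)))"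


section \<open>Monoidal closed structure maps\<close>

definition tensor_map ::
    "('a, 'q::comm_unital_quantale) qcat \<Rightarrow> ('a1, 'q) qcat \<Rightarrow> ('b, 'q) qcat \<Rightarrow> ('b1, 'q) qcat \<Rightarrow>
     ('a \<Rightarrow> 'a1) \<Rightarrow> ('b \<Rightarrow> 'b1) \<Rightarrow> (('a \<times> 'b \<Rightarrow> 'q) \<Rightarrow> ('a1 \<times> 'b1 \<Rightarrow> 'q))" where
  "tensor_map A A1 B B1 F G = tensor_lift A B (A1 \<otimes> B1) (\<lambda>(a, b). pure_tensor A1 B1 (F a) (G b))"

definition associator ::
    "('a, 'q::comm_unital_quantale) qcat \<Rightarrow> ('b, 'q) qcat \<Rightarrow> ('c, 'q) qcat \<Rightarrow>
     (('a \<times> 'b \<Rightarrow> 'q) \<times> 'c \<Rightarrow> 'q) \<Rightarrow> ('a \<times> ('b \<times> 'c \<Rightarrow> 'q) \<Rightarrow> 'q)" where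
  "associator A B C =
     (THE h. h \<in> Mor ((A \<otimes> B) \<otimes> C) (A \<otimes> (B \<otimes> C)) \<and>
        (\<forall>a\<in>obj A. \<forall>b\<in>obj B. \<forall>c\<in>obj C.
           h (pure_tensor (A \<otimes> B) C (pure_tensor A B a b) c) = pure_tensor A (B \<otimes> C) a (pure_tensor B C b c)))"

text \<open>The action \<open>q \<cdot> x\<close> of the \<open>Q\<close>-module of \<open>A\<close> is determined by: \<open>q \<cdot> x \<le> y\<close> iff
  \<open>q \<le> hom A x y\<close>.\<close>

definition act :: "('a, 'q::comm_unital_quantale) qcat \<Rightarrow> 'q \<Rightarrow> 'a \<Rightarrow> 'a" where
  "act A q x = (THE z. z \<in> obj A \<and> (\<forall>y\<in>obj A. qle A z y \<longleftrightarrow> q \<le> hom A x y))"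

definition left_unitor ::
    "('a, 'q::comm_unital_quantale) qcat \<Rightarrow> (('q \<times> 'a \<Rightarrow> 'q) \<Rightarrow> 'a)" where
  "left_unitor A = tensor_lift Q_cat A A (\<lambda>(q, a). act A q a)"

definition right_unitor ::
    "('a, 'q::comm_unital_quantale) qcat \<Rightarrow> (('a \<times> 'q \<Rightarrow> 'q) \<Rightarrow> 'a)" where
  "right_unitor A = tensor_lift A Q_cat A (\<lambda>(a, q). act A q a)"

definition braiding ::
    "('a, 'q::comm_unital_quantale) qcat \<Rightarrow> ('b, 'q) qcat \<Rightarrow>
     ('a \<times> 'b \<Rightarrow> 'q) \<Rightarrow> ('b \<times> 'a \<Rightarrow> 'q)" where
  "braiding A B = tensor_lift A B (B \<otimes> A) (\<lambda>(a, b). pure_tensor B A b a)"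

definition evaluation ::
    "('a, 'q::comm_unital_quantale) qcat \<Rightarrow> ('b, 'q) qcat \<Rightarrow>
     (('a \<Rightarrow> 'b) \<times> 'a \<Rightarrow> 'q) \<Rightarrow> 'b" where
  "evaluation A B = tensor_lift (internal_hom A B) A B (\<lambda>(F, a). F a)"

end

theory Submission
  imports Defs
begin

text \<open>A functor \<open>F : A \<rightarrow> B\<close> is a left adjoint iff all presheaves \<open>hom B (F -) y\<close> are representable,
  and representable presheaves on an object of \<open>Q-Sup\<close> are closed under weighted infima.  The
  pure tensors are dense in \<open>A \<otimes> B\<close>, every \<open>\<psi>\<close> being their supremum weighted by \<open>\<psi>\<close> itself, so
  a bimorphism \<open>f\<close> extends by \<open>\<psi> \<mapsto> sup \<psi> (a, b) \<cdot> f (a, b)\<close>, and every coherence equation can be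
  checked on pure tensors.

  Complete distributivity of \<open>A\<close> is equivalent to the existence of a dual basis: morphisms
  \<open>g\<^sub>i : A \<rightarrow> Q\<close> and objects \<open>d\<^sub>i\<close> such that each \<open>a\<close> is the supremum of the \<open>g\<^sub>i a \<cdot> d\<^sub>i\<close>.  From dual
  bases \<open>(g\<^sub>i, d\<^sub>i)\<close> of \<open>A\<close> and \<open>(h\<^sub>j, e\<^sub>j)\<close> of \<open>B\<close> one obtains the dual basis \<open>(g\<^sub>i \<otimes> h\<^sub>j, d\<^sub>i \<otimes> e\<^sub>j)\<close> of
  \<open>A \<otimes> B\<close>, and one of \<open>B\<^sup>A\<close> consisting of the functionals \<open>F \<mapsto> h\<^sub>j (F d\<^sub>i)\<close> and the morphisms
  \<open>a \<mapsto> g\<^sub>i a \<cdot> e\<^sub>j\<close>.\<close>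


section \<open>Residuation\<close>

text \<open>Yoneda for partial orders. Residuals and infima are known through their lower bounds, so
  identities between them reduce to equivalences of inequalities.\<close>

lemma eq_by_lower_bounds: "(\<And>q. q \<le> a \<longleftrightarrow> q \<le> b) \<Longrightarrow> a = (b :: 'q::order)"
  by (meson order.antisym order.refl)

lemma le_residual_iff:
  fixes a b c :: "'q::comm_unital_quantale"
  shows "q \<le> a \<leadsto> b \<longleftrightarrow> a * q \<le> b"
  by (simp add: residual_adjoint)

lemma mult_mono_quantale:
  fixes a b c d :: "'q::comm_unital_quantale"
  assumes "a \<le> b" "c \<le> d"
  shows "a * c \<le> b * d"
  by (metis assms mult.commute order.trans quantale_mult_mono)

lemma mult_SUP: "(a :: 'q::comm_unital_quantale) * (SUP i\<in>I. f i) = (SUP i\<in>I. a * f i)"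
  by (simp add: mult_Sup image_image)

lemma residual_one [simp]: "(1 :: 'q::comm_unital_quantale) \<leadsto> b = b"
  by (rule eq_by_lower_bounds) (simp add: le_residual_iff)

lemma one_le_residual_iff [simp]: "(1 :: 'q::comm_unital_quantale) \<le> a \<leadsto> b \<longleftrightarrow> a \<le> b"
  by (simp add: le_residual_iff)

text \<open>Multiplication by an element above 1 only enlarges:
  \<open>a \<leadsto> b \<le> a * (a \<leadsto> b) \<le> b\<close>.\<close>

lemma residual_le: "(1 :: 'q::comm_unital_quantale) \<le> a \<Longrightarrow> a \<leadsto> b \<le> b"
  by (metis le_residual_iff mult_1 mult_mono_quantale order.refl order.trans)

lemma residual_INF:
  "(a :: 'q::comm_unital_quantale) \<leadsto> (INF i\<in>I. f i) = (INF i\<in>I. a \<leadsto> f i)"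
  by (rule eq_by_lower_bounds) (simp add: le_residual_iff le_INF_iff)

lemma SUP_residual:
  "(SUP i\<in>I. f i :: 'q::comm_unital_quantale) \<leadsto> b = (INF i\<in>I. f i \<leadsto> b)"
  by (rule eq_by_lower_bounds)
    (simp add: le_residual_iff le_INF_iff SUP_le_iff mult.commute[of "Sup _"] mult_SUP mult.commute)

lemma residual_residual: "(a :: 'q::comm_unital_quantale) \<leadsto> b \<leadsto> c = (a * b) \<leadsto> c"
  by (rule eq_by_lower_bounds) (simp add: le_residual_iff ac_simps)

lemma residual_left_commute:
  "(a :: 'q::comm_unital_quantale) \<leadsto> b \<leadsto> c = b \<leadsto> a \<leadsto> c"
  by (simp add: residual_residual mult.commute)


section \<open>Representable presheaves and weighted suprema\<close>

lemma qcat_refl: "is_qcat A \<Longrightarrow> x \<in> obj A \<Longrightarrow> 1 \<le> hom A x x"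
  by (simp add: is_qcat_def)

lemma qcat_trans:
  "is_qcat A \<Longrightarrow> x \<in> obj A \<Longrightarrow> y \<in> obj A \<Longrightarrow> z \<in> obj A \<Longrightarrow> hom A x y * hom A y z \<le> hom A x z"
  by (metis is_qcat_def mult.commute)

lemma qcat_trans_le:
  assumes "is_qcat A" "x \<in> obj A" "y \<in> obj A" "z \<in> obj A" "p \<le> hom A x y" "q \<le> hom A y z"
  shows "p * q \<le> hom A x z"
  by (meson assms mult_mono_quantale order.trans qcat_trans)

lemma hom_left_eqI:
  assumes "is_qcat A" "skeletal A" "x \<in> obj A" "x' \<in> obj A"
    and "\<And>y. y \<in> obj A \<Longrightarrow> hom A x y = hom A x' y"
  shows "x = x'"
  using assms by (metis qcat_refl qle_def skeletal_def)

text \<open>The Yoneda lemma for representables: the index \<open>z = x\<close> and the identity of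
  \<open>x\<close> give \<open>\<le>\<close>, composition gives \<open>\<ge>\<close>.\<close>

lemma hom_yoneda_INF:
  assumes "is_qcat A" "x \<in> obj A" "y \<in> obj A"
  shows "(INF z\<in>obj A. hom A z x \<leadsto> hom A z y) = hom A x y"
proof (rule order.antisym)
  have "(INF z\<in>obj A. hom A z x \<leadsto> hom A z y) \<le> hom A x x \<leadsto> hom A x y"
    using assms by (intro INF_lower)
  also have "\<dots> \<le> hom A x y"
    using assms by (intro residual_le qcat_refl)
  finally show "(INF z\<in>obj A. hom A z x \<leadsto> hom A z y) \<le> hom A x y" .
  show "hom A x y \<le> (INF z\<in>obj A. hom A z x \<leadsto> hom A z y)"
    using assms by (simp add: le_INF_iff le_residual_iff qcat_trans)
qed

text \<open>The object \<open>z\<close> is what a right adjoint returns. Only the values of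
  \<open>\<phi>\<close> on \<open>obj A\<close> matter, so maps that are not extensional are
  allowed.\<close>

definition representable :: "('a, 'q::comm_unital_quantale) qcat \<Rightarrow> ('a \<Rightarrow> 'q) \<Rightarrow> bool" where
  "representable A \<phi> \<longleftrightarrow> (\<exists>z\<in>obj A. \<forall>x\<in>obj A. \<phi> x = hom A x z)"

lemma representable_cong:
  "(\<And>x. x \<in> obj A \<Longrightarrow> \<phi> x = \<psi> x) \<Longrightarrow> representable A \<phi> \<longleftrightarrow> representable A \<psi>"
  by (simp add: representable_def)

lemma representable_hom: "z \<in> obj A \<Longrightarrow> representable A (\<lambda>x. hom A x z)"
  by (auto simp: representable_def)

text \<open>Index set and weight are arbitrary, so one notion covers joins (all weights 1), the
  action (a single index) and suprema of presheaves (indexed by \<open>obj A\<close>). It is a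
  relation because uniqueness comes from skeletality.\<close>

definition is_wsup ::
    "('a, 'q::comm_unital_quantale) qcat \<Rightarrow> 'i set \<Rightarrow> ('i \<Rightarrow> 'q) \<Rightarrow> ('i \<Rightarrow> 'a) \<Rightarrow> 'a \<Rightarrow> bool" where
  "is_wsup A I w f z \<longleftrightarrow>
     z \<in> obj A \<and> (\<forall>y\<in>obj A. hom A z y = (INF i\<in>I. w i \<leadsto> hom A (f i) y))"

definition wsup ::
    "('a, 'q::comm_unital_quantale) qcat \<Rightarrow> 'i set \<Rightarrow> ('i \<Rightarrow> 'q) \<Rightarrow> ('i \<Rightarrow> 'a) \<Rightarrow> 'a" where
  "wsup A I w f = (SOME z. is_wsup A I w f z)"

section \<open>Adjunctions through representability\<close>

lemma adjointI:
  assumes A: "is_qcat A" and B: "is_qcat B"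
    and F: "F \<in> obj A \<rightarrow> obj B" and G: "G \<in> obj B \<rightarrow> obj A"
    and FG: "\<And>x y. x \<in> obj A \<Longrightarrow> y \<in> obj B \<Longrightarrow> hom B (F x) y = hom A x (G y)"
  shows "adjoint A B F G"
proof -
  have "hom A x x' \<le> hom B (F x) (F x')" if x: "x \<in> obj A" "x' \<in> obj A" for x x'
  proof -
    have FG': "F x \<in> obj B" "F x' \<in> obj B" "G (F x') \<in> obj A"
      using x F G by auto
    \<comment> \<open>The unit of the adjunction; composing with it sends \<open>hom A x x'\<close>
      into \<open>hom A x (G (F x'))\<close>, which transposes to the functoriality of
      \<open>F\<close>.\<close>
    then have "1 \<le> hom A x' (G (F x'))"
      using x B FG[of x' "F x'"] by (metis qcat_refl)
    then have "hom A x x' * 1 \<le> hom A x (G (F x'))"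
      using A x FG' by (intro qcat_trans_le[of A x x']) auto
    then show ?thesis
      using FG x FG' by simp
  qed
  moreover have "hom B y y' \<le> hom A (G y) (G y')" if y: "y \<in> obj B" "y' \<in> obj B" for y y'
  proof -
    have FG': "G y \<in> obj A" "G y' \<in> obj A" "F (G y) \<in> obj B"
      using y F G by auto
    \<comment> \<open>The counit, used dually for \<open>G\<close>.\<close>
    then have "1 \<le> hom B (F (G y)) y"
      using y A FG[of "G y" y] by (metis qcat_refl)
    then have "1 * hom B y y' \<le> hom B (F (G y)) y'"
      using B y FG' by (intro qcat_trans_le[of B _ y]) auto
    then show ?thesis
      using FG y FG' by simp
  qed
  ultimately show ?thesis
    using F G FG by (simp add: adjoint_def qfunctor_def)
qed

text \<open>A choice of representing objects is a right adjoint on objects; \<open>adjointI\<close>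
  supplies the functoriality.\<close>

lemma left_adjoint_iff:
  assumes "is_qcat A" "is_qcat B"
  shows "left_adjoint A B F \<longleftrightarrow>
    F \<in> obj A \<rightarrow> obj B \<and> (\<forall>y\<in>obj B. representable A (\<lambda>x. hom B (F x) y))"
proof
  assume "left_adjoint A B F"
  then obtain G where "adjoint A B F G"
    by (auto simp: left_adjoint_def)
  then show "F \<in> obj A \<rightarrow> obj B \<and> (\<forall>y\<in>obj B. representable A (\<lambda>x. hom B (F x) y))"
    unfolding adjoint_def qfunctor_def representable_def by blast
next
  assume F: "F \<in> obj A \<rightarrow> obj B \<and> (\<forall>y\<in>obj B. representable A (\<lambda>x. hom B (F x) y))"
  then obtain G where "\<forall>y\<in>obj B. G y \<in> obj A \<and> (\<forall>x\<in>obj A. hom B (F x) y = hom A x (G y))"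
    unfolding representable_def by metis
  then have "adjoint A B F G"
    using assms F by (intro adjointI) auto
  then show "left_adjoint A B F"
    by (auto simp: left_adjoint_def)
qed

lemma left_adjoint_in_obj: "left_adjoint A B F \<Longrightarrow> x \<in> obj A \<Longrightarrow> F x \<in> obj B"
  by (auto simp: left_adjoint_def adjoint_def qfunctor_def)

lemma left_adjoint_hom_le:
  "left_adjoint A B F \<Longrightarrow> x \<in> obj A \<Longrightarrow> y \<in> obj A \<Longrightarrow> hom A x y \<le> hom B (F x) (F y)"
  by (auto simp: left_adjoint_def adjoint_def qfunctor_def)

lemma left_adjoint_cong:
  assumes "\<And>x. x \<in> obj A \<Longrightarrow> F x = F' x"
  shows "left_adjoint A B F \<longleftrightarrow> left_adjoint A B F'"
proof -
  have "F \<in> obj A \<rightarrow> obj B \<longleftrightarrow> F' \<in> obj A \<rightarrow> obj B"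
    using assms by (auto simp: Pi_iff)
  then show ?thesis
    using assms by (simp add: left_adjoint_def adjoint_def qfunctor_def)
qed

text \<open>Transposing along the right adjoint \<open>G\<close> turns \<open>hom B (F -) y\<close>
  into \<open>hom A - (G y)\<close>, to which the formula for \<open>z\<close> applies.\<close>

lemma left_adjoint_is_wsup:
  assumes "left_adjoint A B F" "is_wsup A I w f z" "f \<in> I \<rightarrow> obj A"
  shows "is_wsup B I w (\<lambda>i. F (f i)) (F z)"
proof -
  obtain G where G: "G \<in> obj B \<rightarrow> obj A" "F \<in> obj A \<rightarrow> obj B"
    "\<And>x y. x \<in> obj A \<Longrightarrow> y \<in> obj B \<Longrightarrow> hom B (F x) y = hom A x (G y)"
    using assms(1) unfolding left_adjoint_def adjoint_def qfunctor_def by blast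
  have "hom B (F z) y = (INF i\<in>I. w i \<leadsto> hom B (F (f i)) y)" if y: "y \<in> obj B" for y
  proof -
    have "hom B (F z) y = (INF i\<in>I. w i \<leadsto> hom A (f i) (G y))"
      using assms(2) G y by (auto simp: is_wsup_def)
    also have "\<dots> = (INF i\<in>I. w i \<leadsto> hom B (F (f i)) y)"
      using assms(3) G y by (intro INF_cong) (auto simp: Pi_iff)
    finally show ?thesis .
  qed
  then show ?thesis
    using assms(2) G by (auto simp: is_wsup_def)
qed

lemma left_adjoint_comp:
  assumes "left_adjoint A B F" "left_adjoint B C G"
  shows "left_adjoint A C (\<lambda>x. G (F x))"
proof -
  obtain F' G' where F': "adjoint A B F F'" and G': "adjoint B C G G'"
    using assms by (auto simp: left_adjoint_def)
  have "adjoint A C (\<lambda>x. G (F x)) (\<lambda>y. F' (G' y))"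
    unfolding adjoint_def qfunctor_def
  proof (intro conjI ballI)
    fix x y assume xy: "x \<in> obj A" "y \<in> obj A"
    then have "hom A x y \<le> hom B (F x) (F y)" "F x \<in> obj B" "F y \<in> obj B"
      using F' by (auto simp: adjoint_def qfunctor_def)
    moreover from this have "hom B (F x) (F y) \<le> hom C (G (F x)) (G (F y))"
      using G' by (auto simp: adjoint_def qfunctor_def)
    ultimately show "hom A x y \<le> hom C (G (F x)) (G (F y))"
      by simp
  next
    fix x y assume xy: "x \<in> obj C" "y \<in> obj C"
    then have "hom C x y \<le> hom B (G' x) (G' y)" "G' x \<in> obj B" "G' y \<in> obj B"
      using G' by (auto simp: adjoint_def qfunctor_def)
    moreover from this have "hom B (G' x) (G' y) \<le> hom A (F' (G' x)) (F' (G' y))"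
      using F' by (auto simp: adjoint_def qfunctor_def)
    ultimately show "hom C x y \<le> hom A (F' (G' x)) (F' (G' y))"
      by simp
  qed (use F' G' in \<open>auto simp: adjoint_def qfunctor_def Pi_iff\<close>)
  then show ?thesis
    by (auto simp: left_adjoint_def)
qed

lemma left_adjoint_id: "is_qcat A \<Longrightarrow> left_adjoint A A (\<lambda>x. x)"
  by (simp add: left_adjoint_iff representable_hom)

lemma is_wsup_unique:
  assumes "is_qcat A" "skeletal A" "is_wsup A I w f z" "is_wsup A I w f z'"
  shows "z = z'"
  using assms by (intro hom_left_eqI[of A]) (auto simp: is_wsup_def)


section \<open>Pointwise \<open>Q\<close>-categories\<close>

text \<open>Presheaf categories, tensor products and internal homs are all of this form, with
  \<open>D\<close> being \<open>Q_cat\<close> or the target category.\<close>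

lemma pointwise_qcat:
  assumes D: "is_qcat D" and X: "\<And>F p. F \<in> X \<Longrightarrow> p \<in> P \<Longrightarrow> F p \<in> obj D"
  shows "is_qcat \<lparr>obj = X, hom = (\<lambda>F G. INF p\<in>P. hom D (F p) (G p))\<rparr>"
proof -
  have "(INF p\<in>P. hom D (G p) (H p)) * (INF p\<in>P. hom D (F p) (G p)) \<le> (INF p\<in>P. hom D (F p) (H p))"
    if "F \<in> X" "G \<in> X" "H \<in> X" for F G H
  proof (rule INF_greatest)
    fix p assume "p \<in> P"
    then have "(INF p\<in>P. hom D (F p) (G p)) * (INF p\<in>P. hom D (G p) (H p)) \<le> hom D (F p) (H p)"
      using that X D by (intro qcat_trans_le[of D _ "G p"]) (auto intro: INF_lower)
    then show "(INF p\<in>P. hom D (G p) (H p)) * (INF p\<in>P. hom D (F p) (G p)) \<le> hom D (F p) (H p)"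
      by (simp add: mult.commute)
  qed
  then show ?thesis
    using qcat_refl[OF D] X by (simp add: is_qcat_def le_INF_iff)
qed

text \<open>Skeletality of \<open>D\<close> gives agreement on \<open>P\<close>, and extensionality
  settles all other arguments.\<close>

lemma pointwise_skeletal:
  assumes D: "skeletal D" and X: "\<And>F p. F \<in> X \<Longrightarrow> p \<in> P \<Longrightarrow> F p \<in> obj D"
    and ext: "X \<subseteq> extensional P"
  shows "skeletal \<lparr>obj = X, hom = (\<lambda>F G. INF p\<in>P. hom D (F p) (G p))\<rparr>"
  unfolding skeletal_def qle_def
proof (intro ballI impI)
  fix F G
  assume *: "F \<in> obj \<lparr>obj = X, hom = (\<lambda>F G. INF p\<in>P. hom D (F p) (G p))\<rparr>"
    "G \<in> obj \<lparr>obj = X, hom = (\<lambda>F G. INF p\<in>P. hom D (F p) (G p))\<rparr>"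
    "1 \<le> hom \<lparr>obj = X, hom = (\<lambda>F G. INF p\<in>P. hom D (F p) (G p))\<rparr> F G \<and>
     1 \<le> hom \<lparr>obj = X, hom = (\<lambda>F G. INF p\<in>P. hom D (F p) (G p))\<rparr> G F"
  show "F = G"
  proof (rule extensionalityI[of _ P])
    show "F p = G p" if "p \<in> P" for p
      using * that D X by (simp add: skeletal_def qle_def le_INF_iff)
  qed (use * ext in auto)
qed

lemma Q_cat_sel [simp]: "obj Q_cat = UNIV" "hom Q_cat = (\<leadsto>)"
  by (simp_all add: Q_cat_def)

lemma qop_sel [simp]: "obj (qop A) = obj A" "hom (qop A) x y = hom A y x"
  by (simp_all add: qop_def)

lemma Q_cat_qcat: "is_qcat (Q_cat :: ('q::comm_unital_quantale, 'q) qcat)"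
proof -
  have "(y \<leadsto> z) * (x \<leadsto> y) \<le> x \<leadsto> z" for x y z :: 'q
  proof -
    have "x * (x \<leadsto> y) \<le> y" "y * (y \<leadsto> z) \<le> z"
      by (simp_all flip: le_residual_iff)
    then have "(x * (x \<leadsto> y)) * (y \<leadsto> z) \<le> z"
      by (meson mult_mono_quantale order.refl order.trans)
    then show ?thesis
      by (simp add: le_residual_iff ac_simps)
  qed
  then show ?thesis
    by (simp add: is_qcat_def)
qed

lemma Q_cat_skeletal: "skeletal (Q_cat :: ('q::comm_unital_quantale, 'q) qcat)"
  by (auto simp: skeletal_def qle_def intro: order.antisym)

lemma qop_qcat: "is_qcat A \<Longrightarrow> is_qcat (qop A)"
  unfolding is_qcat_def by (metis mult.commute qop_sel)

section \<open>Presheaf categories and the Yoneda lemma\<close>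

lemma presheaf_cat_sel:
  "obj (presheaf_cat A) =
     {\<phi> \<in> extensional (obj A). \<forall>x\<in>obj A. \<forall>y\<in>obj A. \<phi> y * hom A x y \<le> \<phi> x}"
  "hom (presheaf_cat A) \<phi> \<psi> = (INF x\<in>obj A. \<phi> x \<leadsto> \<psi> x)"
  by (simp_all add: presheaf_cat_def)

lemma presheaf_cat_qcat: "is_qcat (presheaf_cat A)"
  using pointwise_qcat[OF Q_cat_qcat] by (simp add: presheaf_cat_def)

text \<open>The factor \<open>hom A x y\<close> distributes over the supremum. With representables
  for \<open>\<phi> i\<close> this yields the presheaf generated by a weighted family of
  objects.\<close>

lemma SUP_presheaf:
  assumes "is_qcat A" and "\<And>i x y. \<lbrakk>i \<in> I; x \<in> obj A; y \<in> obj A\<rbrakk> \<Longrightarrow> \<phi> i y * hom A x y \<le> \<phi> i x"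
  shows "(\<lambda>x\<in>obj A. SUP i\<in>I. w i * \<phi> i x) \<in> obj (presheaf_cat A)"
proof -
  have "(SUP i\<in>I. w i * \<phi> i y) * hom A x y \<le> (SUP i\<in>I. w i * \<phi> i x)"
    if "x \<in> obj A" "y \<in> obj A" for x y
  proof -
    have "w i * (\<phi> i y * hom A x y) \<le> w i * \<phi> i x" if "i \<in> I" for i
      using assms(2) that \<open>x \<in> obj A\<close> \<open>y \<in> obj A\<close> by (intro quantale_mult_mono) auto
    then have "(SUP i\<in>I. hom A x y * (w i * \<phi> i y)) \<le> (SUP i\<in>I. w i * \<phi> i x)"
      by (intro SUP_mono) (auto simp: ac_simps)
    then show ?thesis
      by (simp add: mult.commute[of _ "hom A x y"] mult_SUP)
  qed
  then show ?thesis
    by (simp add: presheaf_cat_sel)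
qed

lemma hom_presheaf:
  "is_qcat A \<Longrightarrow> x \<in> obj A \<Longrightarrow> y \<in> obj A \<Longrightarrow> z \<in> obj A \<Longrightarrow> hom A y z * hom A x y \<le> hom A x z"
  by (simp add: is_qcat_def)

lemma yoneda_in_presheaf: "is_qcat A \<Longrightarrow> z \<in> obj A \<Longrightarrow> yoneda A z \<in> obj (presheaf_cat A)"
  by (simp add: presheaf_cat_sel yoneda_def hom_presheaf)

lemma hom_presheaf_yoneda:
  "hom (presheaf_cat A) \<phi> (yoneda A y) = (INF x\<in>obj A. \<phi> x \<leadsto> hom A x y)"
  unfolding presheaf_cat_sel by (intro INF_cong) (auto simp: yoneda_def)

text \<open>The Yoneda lemma: the left side is the hom from the presheaf represented by
  \<open>z\<close> to \<open>\<phi>\<close>.\<close>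

lemma presheaf_INF_residual:
  assumes A: "is_qcat A" and \<phi>: "\<phi> \<in> obj (presheaf_cat A)" and z: "z \<in> obj A"
  shows "(INF x\<in>obj A. hom A x z \<leadsto> \<phi> x) = \<phi> z"
proof (rule order.antisym)
  have "(INF x\<in>obj A. hom A x z \<leadsto> \<phi> x) \<le> hom A z z \<leadsto> \<phi> z"
    using z by (intro INF_lower)
  also have "\<dots> \<le> \<phi> z"
    using A z by (intro residual_le qcat_refl)
  finally show "(INF x\<in>obj A. hom A x z \<leadsto> \<phi> x) \<le> \<phi> z" .
  show "\<phi> z \<le> (INF x\<in>obj A. hom A x z \<leadsto> \<phi> x)"
    using \<phi> z by (simp add: le_INF_iff le_residual_iff presheaf_cat_sel mult.commute[of "hom A _ z"])
qed


section \<open>Objects of \<open>Q-Sup\<close>\<close>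

lemma QSup_qcat [simp]: "QSup A \<Longrightarrow> is_qcat A"
  and QSup_skeletal [simp]: "QSup A \<Longrightarrow> skeletal A"
  by (simp_all add: QSup_def)

text \<open>Between presheaves, the hom out of a weighted supremum is the weighted infimum of the
  homs out of its members.\<close>

lemma INF_SUP_residual:
  fixes w :: "'i \<Rightarrow> 'q::comm_unital_quantale"
  shows "(INF x\<in>X. (SUP i\<in>I. w i * \<phi> i x) \<leadsto> \<psi> x) = (INF i\<in>I. w i \<leadsto> (INF x\<in>X. \<phi> i x \<leadsto> \<psi> x))"
  unfolding SUP_residual residual_INF residual_residual by (rule INF_commute)

text \<open>Cocompleteness speaks of suprema of presheaves, so the weighted family \<open>f\<close>
  is first replaced by the presheaf that it generates.\<close>

lemma ex_is_wsup:
  assumes A: "QSup A" and f: "f \<in> I \<rightarrow> obj A"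
  shows "\<exists>z. is_wsup A I w f z"
proof -
  obtain S where S: "adjoint (presheaf_cat A) A S (yoneda A)"
    using A unfolding QSup_def cocomplete_def by blast
  define \<phi> where "\<phi> = (\<lambda>x\<in>obj A. SUP i\<in>I. w i * hom A x (f i))"
  have \<phi>: "\<phi> \<in> obj (presheaf_cat A)"
    unfolding \<phi>_def using A f by (intro SUP_presheaf) (auto intro: hom_presheaf)
  have "hom A (S \<phi>) y = (INF i\<in>I. w i \<leadsto> hom A (f i) y)" if y: "y \<in> obj A" for y
  proof -
    have "hom A (S \<phi>) y = hom (presheaf_cat A) \<phi> (yoneda A y)"
      using S \<phi> y by (simp add: adjoint_def)
    also have "\<dots> = (INF x\<in>obj A. (SUP i\<in>I. w i * hom A x (f i)) \<leadsto> hom A x y)"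
      unfolding hom_presheaf_yoneda by (intro INF_cong) (auto simp: \<phi>_def)
    also have "\<dots> = (INF i\<in>I. w i \<leadsto> (INF x\<in>obj A. hom A x (f i) \<leadsto> hom A x y))"
      by (rule INF_SUP_residual)
    also have "\<dots> = (INF i\<in>I. w i \<leadsto> hom A (f i) y)"
      using A f y by (intro INF_cong) (auto simp: hom_yoneda_INF Pi_iff)
    finally show ?thesis .
  qed
  moreover have "S \<phi> \<in> obj A"
    using S \<phi> by (auto simp: adjoint_def qfunctor_def)
  ultimately show ?thesis
    by (auto simp: is_wsup_def)
qed

lemma is_wsup_wsup: "QSup A \<Longrightarrow> f \<in> I \<rightarrow> obj A \<Longrightarrow> is_wsup A I w f (wsup A I w f)"
  unfolding wsup_def by (rule someI_ex) (rule ex_is_wsup)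

lemma wsup_in_obj [simp]: "QSup A \<Longrightarrow> f \<in> I \<rightarrow> obj A \<Longrightarrow> wsup A I w f \<in> obj A"
  using is_wsup_wsup[of A f I w] by (simp add: is_wsup_def)

lemma hom_wsup:
  "QSup A \<Longrightarrow> f \<in> I \<rightarrow> obj A \<Longrightarrow> y \<in> obj A \<Longrightarrow>
    hom A (wsup A I w f) y = (INF i\<in>I. w i \<leadsto> hom A (f i) y)"
  using is_wsup_wsup[of A f I w] by (simp add: is_wsup_def)

lemma presheaf_adjoint_yoneda:
  assumes A: "is_qcat A" and S: "\<And>\<phi>. \<phi> \<in> obj (presheaf_cat A) \<Longrightarrow> is_wsup A (obj A) \<phi> (\<lambda>x. x) (S \<phi>)"
  shows "adjoint (presheaf_cat A) A S (yoneda A)"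
proof (rule adjointI[OF presheaf_cat_qcat A])
  show "S \<in> obj (presheaf_cat A) \<rightarrow> obj A"
    using S by (simp add: is_wsup_def)
  show "yoneda A \<in> obj A \<rightarrow> obj (presheaf_cat A)"
    using A by (simp add: yoneda_in_presheaf)
  show "hom A (S \<phi>) y = hom (presheaf_cat A) \<phi> (yoneda A y)"
    if "\<phi> \<in> obj (presheaf_cat A)" "y \<in> obj A" for \<phi> y
    using S that by (simp add: is_wsup_def hom_presheaf_yoneda)
qed

lemma QSupI:
  assumes A: "is_qcat A" and "skeletal A"
    and wsup: "\<And>w. \<exists>z. is_wsup A (obj A) w (\<lambda>x. x) z"
  shows "QSup A"
proof -
  obtain S where "\<And>w. is_wsup A (obj A) w (\<lambda>x. x) (S w)"
    using wsup by metis
  then have "adjoint (presheaf_cat A) A S (yoneda A)"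
    using A by (intro presheaf_adjoint_yoneda)
  then show ?thesis
    using assms unfolding QSup_def cocomplete_def by blast
qed

text \<open>The weighted supremum is the weighted infimum of its upper bounds.\<close>

lemma QSupI_winf:
  assumes A: "is_qcat A" and sk: "skeletal A"
    and winf: "\<And>w. \<exists>z\<in>obj A. \<forall>x\<in>obj A. hom A x z = (INF y\<in>obj A. w y \<leadsto> hom A x y)"
  shows "QSup A"
proof (rule QSupI[OF A sk])
  fix w :: "'a \<Rightarrow> 'b"
  \<comment> \<open>The degree to which \<open>y\<close> is an upper bound; it has to turn out to be
    \<open>hom A z y\<close>.\<close>
  define u where "u y = (INF x\<in>obj A. w x \<leadsto> hom A x y)" for y
  obtain z where z: "z \<in> obj A" "\<And>x. x \<in> obj A \<Longrightarrow> hom A x z = (INF y\<in>obj A. u y \<leadsto> hom A x y)"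
    using winf by metis
  \<comment> \<open>\<open>z\<close> is an upper bound, because every \<open>y\<close> is one to the
    degree \<open>u y\<close>.\<close>
  have "w x \<le> hom A x z" if "x \<in> obj A" for x
  proof -
    have "u y \<le> w x \<leadsto> hom A x y" for y
      unfolding u_def using that by (intro INF_lower)
    then show ?thesis
      using z that by (simp add: le_INF_iff le_residual_iff mult.commute)
  qed
  then have "hom A z y \<le> u y" if "y \<in> obj A" for y
    using A z(1) that by (auto simp: u_def le_INF_iff le_residual_iff intro!: qcat_trans_le[of A _ z])
  \<comment> \<open>The identity of \<open>z\<close>, read through the formula for \<open>z\<close>
    at \<open>x = z\<close>, places \<open>z\<close> below all upper bounds.\<close>
  moreover have "1 \<le> (INF y\<in>obj A. u y \<leadsto> hom A z y)"
    using A z by (metis qcat_refl)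
  then have "u y \<le> hom A z y" if "y \<in> obj A" for y
    using that by (simp add: le_INF_iff)
  ultimately have "is_wsup A (obj A) w (\<lambda>x. x) z"
    using z(1) by (auto simp: is_wsup_def u_def intro!: order.antisym)
  then show "\<exists>z. is_wsup A (obj A) w (\<lambda>x. x) z" ..
qed

text \<open>The weighted infimum of the representing objects represents the infimum of the
  presheaves; it is constructed as the supremum of its lower bounds, with weight
  \<open>u\<close>.\<close>

lemma representable_INF:
  assumes A: "QSup A" and \<phi>: "\<And>i. i \<in> I \<Longrightarrow> representable A (\<phi> i)"
  shows "representable A (\<lambda>x. INF i\<in>I. w i \<leadsto> \<phi> i x)"
proof -
  have "\<forall>i\<in>I. \<exists>z. z \<in> obj A \<and> (\<forall>x\<in>obj A. \<phi> i x = hom A x z)"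
    using \<phi> by (auto simp: representable_def)
  then obtain f where "\<forall>i\<in>I. f i \<in> obj A \<and> (\<forall>x\<in>obj A. \<phi> i x = hom A x (f i))"
    by metis
  then have f: "\<And>i. i \<in> I \<Longrightarrow> f i \<in> obj A"
    "\<And>i x. i \<in> I \<Longrightarrow> x \<in> obj A \<Longrightarrow> \<phi> i x = hom A x (f i)"
    by auto
  define u where "u x = (INF i\<in>I. w i \<leadsto> hom A x (f i))" for x
  obtain z where "is_wsup A (obj A) u (\<lambda>x. x) z"
    using ex_is_wsup[OF A, of "\<lambda>x. x" "obj A"] by auto
  then have z: "z \<in> obj A" "\<And>y. y \<in> obj A \<Longrightarrow> hom A z y = (INF x\<in>obj A. u x \<leadsto> hom A x y)"
    by (auto simp: is_wsup_def)
  have "u x \<le> w i \<leadsto> hom A x (f i)" if "i \<in> I" for i x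
    unfolding u_def using that by (intro INF_lower)
  then have "w i \<le> hom A z (f i)" if "i \<in> I" for i
    using that z f by (simp add: le_INF_iff le_residual_iff mult.commute)
  then have "w i * hom A x z \<le> hom A x (f i)" if "x \<in> obj A" "i \<in> I" for x i
    unfolding mult.commute[of "w i"] using A z f that
    by (intro qcat_trans_le[of A _ z]) auto
  then have "hom A x z \<le> u x" if "x \<in> obj A" for x
    using that by (simp add: u_def le_INF_iff le_residual_iff)
  moreover have "1 \<le> (INF x\<in>obj A. u x \<leadsto> hom A x z)"
    using A z by (metis qcat_refl QSup_qcat)
  then have "u x \<le> hom A x z" if "x \<in> obj A" for x
    using that by (simp add: le_INF_iff)
  moreover have "(INF i\<in>I. w i \<leadsto> \<phi> i x) = u x" if "x \<in> obj A" for x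
    unfolding u_def using f that by (intro INF_cong) auto
  ultimately show ?thesis
    unfolding representable_def using z(1) order.antisym by metis
qed

lemma representable_residual:
  "QSup A \<Longrightarrow> representable A \<phi> \<Longrightarrow> representable A (\<lambda>x. q \<leadsto> \<phi> x)"
  using representable_INF[of A "{()}" "\<lambda>_. \<phi>" "\<lambda>_. q"] by simp

text \<open>The right adjoint of \<open>\<phi>\<close> sends \<open>q\<close> to the object representing \<open>q \<leadsto> \<phi>\<close>, and these objects all exist
  once the one for \<open>q = 1\<close> does.\<close>

lemma left_adjoint_qop_Q_iff:
  assumes "QSup A"
  shows "left_adjoint A (qop Q_cat) \<phi> \<longleftrightarrow> representable A \<phi>"
proof -
  have "left_adjoint A (qop Q_cat) \<phi> \<longleftrightarrow> (\<forall>q. representable A (\<lambda>x. q \<leadsto> \<phi> x))"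
    using assms by (simp add: left_adjoint_iff qop_qcat Q_cat_qcat)
  also have "\<dots> \<longleftrightarrow> representable A \<phi>"
  proof
    assume "\<forall>q. representable A (\<lambda>x. q \<leadsto> \<phi> x)"
    then have "representable A (\<lambda>x. 1 \<leadsto> \<phi> x)" ..
    then show "representable A \<phi>"
      by simp
  qed (use assms representable_residual in blast)
  finally show ?thesis .
qed

lemma left_adjoint_Q_iff:
  assumes "is_qcat A"
  shows "left_adjoint A Q_cat g \<longleftrightarrow> (\<forall>q. representable A (\<lambda>x. g x \<leadsto> q))"
  using assms by (simp add: left_adjoint_iff Q_cat_qcat)


section \<open>The universal property of the tensor product\<close>

lemma Mor_left_adjoint: "F \<in> Mor A B \<Longrightarrow> left_adjoint A B F"
  by (simp add: Mor_def)

lemma Mor_in_obj [simp]: "F \<in> Mor A B \<Longrightarrow> x \<in> obj A \<Longrightarrow> F x \<in> obj B"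
  by (auto simp: Mor_def left_adjoint_in_obj)

lemma restrict_Mor: "left_adjoint A B F \<Longrightarrow> restrict F (obj A) \<in> Mor A B"
  using left_adjoint_cong[of A "restrict F (obj A)" F B] by (simp add: Mor_def)

lemma Mor_eqI: "F \<in> Mor A B \<Longrightarrow> F' \<in> Mor A B \<Longrightarrow> (\<And>x. x \<in> obj A \<Longrightarrow> F x = F' x) \<Longrightarrow> F = F'"
  by (auto simp: Mor_def intro: extensionalityI)

lemma hom_tensor: "hom (A \<otimes> B) \<phi> \<psi> = (INF p\<in>obj A \<times> obj B. \<phi> p \<leadsto> \<psi> p)"
  by (simp add: tensor_def)

lemma obj_tensor_iff:
  assumes "QSup A" "QSup B"
  shows "\<phi> \<in> obj (A \<otimes> B) \<longleftrightarrow> \<phi> \<in> extensional (obj A \<times> obj B) \<and>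
    (\<forall>a\<in>obj A. representable B (\<lambda>b. \<phi> (a, b))) \<and> (\<forall>b\<in>obj B. representable A (\<lambda>a. \<phi> (a, b)))"
  using assms by (simp add: tensor_def bimorphism_def left_adjoint_qop_Q_iff)

lemma restrict_tensor_iff:
  assumes "QSup A" "QSup B"
  shows "restrict \<phi> (obj A \<times> obj B) \<in> obj (A \<otimes> B) \<longleftrightarrow>
    (\<forall>a\<in>obj A. representable B (\<lambda>b. \<phi> (a, b))) \<and> (\<forall>b\<in>obj B. representable A (\<lambda>a. \<phi> (a, b)))"
proof -
  have "representable B (\<lambda>b. restrict \<phi> (obj A \<times> obj B) (a, b)) \<longleftrightarrow> representable B (\<lambda>b. \<phi> (a, b))"
    if "a \<in> obj A" for a
    using that by (intro representable_cong) simp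
  moreover have "representable A (\<lambda>a. restrict \<phi> (obj A \<times> obj B) (a, b)) \<longleftrightarrow> representable A (\<lambda>a. \<phi> (a, b))"
    if "b \<in> obj B" for b
    using that by (intro representable_cong) simp
  ultimately show ?thesis
    using assms by (simp add: obj_tensor_iff)
qed

text \<open>Representability in each variable survives pointwise weighted infima. Pointwise suprema
  may destroy it, which is why \<open>A \<otimes> B\<close> is shown to be complete through
  infima.\<close>

lemma INF_in_tensor:
  assumes "QSup A" "QSup B" "\<And>i. i \<in> I \<Longrightarrow> \<phi> i \<in> obj (A \<otimes> B)"
  shows "(\<lambda>p\<in>obj A \<times> obj B. INF i\<in>I. w i \<leadsto> \<phi> i p) \<in> obj (A \<otimes> B)"
  unfolding restrict_tensor_iff[OF assms(1,2)]
  using assms by (simp add: obj_tensor_iff representable_INF)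

text \<open>The pointwise infimum is also the weighted infimum for the hom, since the residuals by
  \<open>w i\<close> and by \<open>\<psi> p\<close> commute, and so do the two infima.\<close>

lemma hom_tensor_INF:
  "hom (A \<otimes> B) \<psi> (\<lambda>p\<in>obj A \<times> obj B. INF i\<in>I. w i \<leadsto> \<phi> i p) = (INF i\<in>I. w i \<leadsto> hom (A \<otimes> B) \<psi> (\<phi> i))"
proof -
  have "hom (A \<otimes> B) \<psi> (\<lambda>p\<in>obj A \<times> obj B. INF i\<in>I. w i \<leadsto> \<phi> i p) =
      (INF p\<in>obj A \<times> obj B. INF i\<in>I. w i \<leadsto> \<psi> p \<leadsto> \<phi> i p)"
    unfolding hom_tensor by (intro INF_cong) (simp_all add: residual_INF residual_left_commute)
  also have "\<dots> = (INF i\<in>I. w i \<leadsto> hom (A \<otimes> B) \<psi> (\<phi> i))"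
    unfolding hom_tensor residual_INF by (rule INF_commute)
  finally show ?thesis .
qed

lemma tensor_QSup [simp]:
  assumes "QSup A" "QSup B"
  shows "QSup (A \<otimes> B)"
proof (rule QSupI_winf)
  show "is_qcat (A \<otimes> B)"
    using pointwise_qcat[OF Q_cat_qcat, of "obj (A \<otimes> B)" "obj A \<times> obj B"] by (simp add: tensor_def)
  show "skeletal (A \<otimes> B)"
    using pointwise_skeletal[OF Q_cat_skeletal, of "obj (A \<otimes> B)" "obj A \<times> obj B"]
    by (simp add: tensor_def)
  show "\<exists>\<zeta>\<in>obj (A \<otimes> B). \<forall>\<psi>\<in>obj (A \<otimes> B).
      hom (A \<otimes> B) \<psi> \<zeta> = (INF \<phi>\<in>obj (A \<otimes> B). w \<phi> \<leadsto> hom (A \<otimes> B) \<psi> \<phi>)" for w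
    using INF_in_tensor[OF assms, of "obj (A \<otimes> B)" "\<lambda>\<phi>. \<phi>" w]
      hom_tensor_INF[of A B _ w "\<lambda>\<phi>. \<phi>" "obj (A \<otimes> B)"] by blast
qed

lemma pure_in_tensor [simp]: "QSup A \<Longrightarrow> QSup B \<Longrightarrow> pure_tensor A B a b \<in> obj (A \<otimes> B)"
  unfolding pure_tensor_def by (rule INF_in_tensor)

text \<open>A Yoneda argument: at \<open>(a, b)\<close> the pure tensor is at least 1, and its
  defining infimum keeps it below \<open>\<psi> (a, b) \<leadsto> \<psi> p\<close> at every
  \<open>p\<close>.\<close>

lemma hom_pure:
  assumes "\<psi> \<in> obj (A \<otimes> B)" "a \<in> obj A" "b \<in> obj B"
  shows "hom (A \<otimes> B) (pure_tensor A B a b) \<psi> = \<psi> (a, b)"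
proof (rule order.antisym)
  have "hom (A \<otimes> B) (pure_tensor A B a b) \<psi> \<le> pure_tensor A B a b (a, b) \<leadsto> \<psi> (a, b)"
    unfolding hom_tensor using assms by (intro INF_lower) auto
  also have "\<dots> \<le> \<psi> (a, b)"
    using assms by (intro residual_le) (simp add: pure_tensor_def le_INF_iff)
  finally show "hom (A \<otimes> B) (pure_tensor A B a b) \<psi> \<le> \<psi> (a, b)" .
  have "pure_tensor A B a b p \<le> \<psi> (a, b) \<leadsto> \<psi> p" if "p \<in> obj A \<times> obj B" for p
    using assms that by (auto simp: pure_tensor_def intro: INF_lower)
  then show "\<psi> (a, b) \<le> hom (A \<otimes> B) (pure_tensor A B a b) \<psi>"
    by (simp add: hom_tensor le_INF_iff le_residual_iff mult.commute[of "pure_tensor A B a b _"])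
qed

text \<open>Density of the pure tensors: by \<open>hom_pure\<close> the pointwise hom out of
  \<open>\<psi>\<close> is, term by term, the formula of this supremum.\<close>

lemma is_wsup_pure:
  assumes "\<psi> \<in> obj (A \<otimes> B)"
  shows "is_wsup (A \<otimes> B) (obj A \<times> obj B) \<psi> (\<lambda>(a, b). pure_tensor A B a b) \<psi>"
  unfolding is_wsup_def hom_tensor[of A B \<psi>]
  using assms by (auto simp: hom_pure intro!: INF_cong)

text \<open>Both maps preserve the supremum that presents \<open>\<psi>\<close> by pure tensors.
  Using \<open>left_adjoint\<close> in place of \<open>Mor\<close> admits partial applications such
  as \<open>\<lambda>t. F (pure_tensor (A \<otimes> B) C t c)\<close>.\<close>

lemma tensor_eqI:
  assumes AB: "QSup A" "QSup B" and C: "is_qcat C" "skeletal C"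
    and F: "left_adjoint (A \<otimes> B) C F" and F': "left_adjoint (A \<otimes> B) C F'"
    and eq: "\<And>a b. a \<in> obj A \<Longrightarrow> b \<in> obj B \<Longrightarrow> F (pure_tensor A B a b) = F' (pure_tensor A B a b)"
    and \<psi>: "\<psi> \<in> obj (A \<otimes> B)"
  shows "F \<psi> = F' \<psi>"
proof (rule is_wsup_unique[OF C])
  let ?pure = "\<lambda>(a, b). pure_tensor A B a b"
  have pure: "?pure \<in> obj A \<times> obj B \<rightarrow> obj (A \<otimes> B)"
    using AB by auto
  show "is_wsup C (obj A \<times> obj B) \<psi> (\<lambda>p. F (?pure p)) (F \<psi>)"
    using F is_wsup_pure[OF \<psi>] pure by (rule left_adjoint_is_wsup)
  have "is_wsup C (obj A \<times> obj B) \<psi> (\<lambda>p. F' (?pure p)) (F' \<psi>)"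
    using F' is_wsup_pure[OF \<psi>] pure by (rule left_adjoint_is_wsup)
  then show "is_wsup C (obj A \<times> obj B) \<psi> (\<lambda>p. F (?pure p)) (F' \<psi>)"
    using eq by (auto simp: is_wsup_def intro!: INF_cong)
qed

section \<open>Bimorphisms and their extensions\<close>

lemma bimorphism_iff:
  assumes "QSup A" "QSup B" "is_qcat C"
  shows "bimorphism A B C f \<longleftrightarrow>
    (\<forall>a\<in>obj A. \<forall>b\<in>obj B. f (a, b) \<in> obj C) \<and>
    (\<forall>y\<in>obj C. (\<forall>a\<in>obj A. representable B (\<lambda>b. hom C (f (a, b)) y)) \<and>
                (\<forall>b\<in>obj B. representable A (\<lambda>a. hom C (f (a, b)) y)))"
  using assms by (auto simp: bimorphism_def left_adjoint_iff Pi_iff)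

text \<open>As \<open>y\<close> varies, this is the right adjoint of the extension of
  \<open>f\<close> to \<open>A \<otimes> B\<close>.\<close>

lemma bimorphism_hom_in_tensor:
  assumes "QSup A" "QSup B" "is_qcat C" "bimorphism A B C f" "y \<in> obj C"
  shows "(\<lambda>p\<in>obj A \<times> obj B. hom C (f p) y) \<in> obj (A \<otimes> B)"
  unfolding restrict_tensor_iff[OF assms(1,2)] using assms by (simp add: bimorphism_iff)

text \<open>By \<open>hom_pure\<close> the hom from the pure tensor of \<open>a\<close> and
  \<open>b\<close> to \<open>\<psi>\<close> is \<open>\<psi> (a, b)\<close>, which is representable
  in each variable by the construction of \<open>A \<otimes> B\<close>.\<close>

lemma bimorphism_pure:
  assumes "QSup A" "QSup B"
  shows "bimorphism A B (A \<otimes> B) (\<lambda>(a, b). pure_tensor A B a b)"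
proof -
  have "representable B (\<lambda>b. hom (A \<otimes> B) (pure_tensor A B a b) \<psi>)"
    if "\<psi> \<in> obj (A \<otimes> B)" "a \<in> obj A" for a \<psi>
  proof -
    have "representable B (\<lambda>b. \<psi> (a, b))"
      using that assms by (simp add: obj_tensor_iff)
    then show ?thesis
      using that representable_cong[of B "\<lambda>b. hom (A \<otimes> B) (pure_tensor A B a b) \<psi>"]
      by (simp add: hom_pure)
  qed
  moreover have "representable A (\<lambda>a. hom (A \<otimes> B) (pure_tensor A B a b) \<psi>)"
    if "\<psi> \<in> obj (A \<otimes> B)" "b \<in> obj B" for b \<psi>
  proof -
    have "representable A (\<lambda>a. \<psi> (a, b))"
      using that assms by (simp add: obj_tensor_iff)
    then show ?thesis
      using that representable_cong[of A "\<lambda>a. hom (A \<otimes> B) (pure_tensor A B a b) \<psi>"]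
      by (simp add: hom_pure)
  qed
  ultimately show ?thesis
    using assms by (simp add: bimorphism_iff)
qed

lemma ex1_tensor_lift:
  assumes AB: "QSup A" "QSup B" and C: "QSup C" and f: "bimorphism A B C f"
  shows "\<exists>!h. h \<in> Mor (A \<otimes> B) C \<and> (\<forall>a\<in>obj A. \<forall>b\<in>obj B. h (pure_tensor A B a b) = f (a, b))"
proof (rule ex_ex1I)
  have f_obj: "f \<in> obj A \<times> obj B \<rightarrow> obj C"
    using f AB C by (auto simp: bimorphism_iff)
  \<comment> \<open>The only possible value, as an extension has to preserve the supremum presenting
    \<open>\<psi>\<close> by pure tensors.\<close>
  define h where "h \<psi> = wsup C (obj A \<times> obj B) \<psi> f" for \<psi>
  have h_obj: "h \<psi> \<in> obj C" for \<psi>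
    using C f_obj by (simp add: h_def)
  \<comment> \<open>The adjunction, with the right adjoint sending \<open>y\<close> to
    \<open>hom C (f -) y\<close>.\<close>
  have hom_h: "hom C (h \<psi>) y = hom (A \<otimes> B) \<psi> (\<lambda>p\<in>obj A \<times> obj B. hom C (f p) y)"
    if "y \<in> obj C" for \<psi> y
    unfolding h_def hom_wsup[OF C f_obj that] hom_tensor by (intro INF_cong) auto
  have "left_adjoint (A \<otimes> B) C h"
    using AB C h_obj bimorphism_hom_in_tensor[OF AB _ f]
    by (simp add: left_adjoint_iff hom_h representable_hom)
  moreover have "h (pure_tensor A B a b) = f (a, b)" if "a \<in> obj A" "b \<in> obj B" for a b
    using that AB C h_obj f_obj bimorphism_hom_in_tensor[OF AB _ f]
    by (intro hom_left_eqI[of C]) (auto simp: hom_h hom_pure)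
  ultimately show "\<exists>h. h \<in> Mor (A \<otimes> B) C \<and> (\<forall>a\<in>obj A. \<forall>b\<in>obj B. h (pure_tensor A B a b) = f (a, b))"
    using AB by (intro exI[of _ "restrict h (obj (A \<otimes> B))"]) (simp add: restrict_Mor)
next
  fix h h'
  assume h: "h \<in> Mor (A \<otimes> B) C \<and> (\<forall>a\<in>obj A. \<forall>b\<in>obj B. h (pure_tensor A B a b) = f (a, b))"
    and h': "h' \<in> Mor (A \<otimes> B) C \<and> (\<forall>a\<in>obj A. \<forall>b\<in>obj B. h' (pure_tensor A B a b) = f (a, b))"
  show "h = h'"
  proof (rule Mor_eqI)
    show "h \<psi> = h' \<psi>" if "\<psi> \<in> obj (A \<otimes> B)" for \<psi>
      by (rule tensor_eqI[OF AB QSup_qcat[OF C] QSup_skeletal[OF C] _ _ _ that]) (use h h' in \<open>simp_all add: Mor_left_adjoint\<close>)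
  qed (use h h' in auto)
qed

lemma
  assumes "QSup A" "QSup B" "QSup C" "bimorphism A B C f"
  shows tensor_lift_Mor: "tensor_lift A B C f \<in> Mor (A \<otimes> B) C"
    and tensor_lift_pure:
      "\<And>a b. a \<in> obj A \<Longrightarrow> b \<in> obj B \<Longrightarrow> tensor_lift A B C f (pure_tensor A B a b) = f (a, b)"
  using theI'[OF ex1_tensor_lift[OF assms]] by (simp_all add: tensor_lift_def)

text \<open>The extension preserves the supremum presenting \<open>\<psi>\<close>, so its values
  follow from those on pure tensors.\<close>

lemma hom_tensor_lift:
  assumes ABC: "QSup A" "QSup B" "QSup C" and f: "bimorphism A B C f"
    and \<psi>: "\<psi> \<in> obj (A \<otimes> B)" and y: "y \<in> obj C"
  shows "hom C (tensor_lift A B C f \<psi>) y = (INF p\<in>obj A \<times> obj B. \<psi> p \<leadsto> hom C (f p) y)"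
proof -
  have "is_wsup C (obj A \<times> obj B) \<psi>
      (\<lambda>p. tensor_lift A B C f ((\<lambda>(a, b). pure_tensor A B a b) p)) (tensor_lift A B C f \<psi>)"
    using ABC
    by (intro left_adjoint_is_wsup[OF Mor_left_adjoint[OF tensor_lift_Mor[OF ABC f]] is_wsup_pure[OF \<psi>]]) auto
  then have "hom C (tensor_lift A B C f \<psi>) y =
      (INF p\<in>obj A \<times> obj B. \<psi> p \<leadsto> hom C (tensor_lift A B C f ((\<lambda>(a, b). pure_tensor A B a b) p)) y)"
    using y by (simp add: is_wsup_def)
  also have "\<dots> = (INF p\<in>obj A \<times> obj B. \<psi> p \<leadsto> hom C (f p) y)"
    using ABC f by (intro INF_cong) (auto simp: tensor_lift_pure)
  finally show ?thesis .
qed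


section \<open>Complete distributivity and dual bases\<close>

lemma residual_mono: "(b :: 'q::comm_unital_quantale) \<le> c \<Longrightarrow> a \<leadsto> b \<le> a \<leadsto> c"
  by (meson le_residual_iff order.refl order.trans)

lemma INF_Times:
  fixes f :: "'i \<Rightarrow> 'j \<Rightarrow> 'q::complete_lattice"
  shows "(INF (i, j)\<in>I \<times> J. f i j) = (INF i\<in>I. INF j\<in>J. f i j)"
  by (rule eq_by_lower_bounds) (auto simp: le_INF_iff)

text \<open>Hom into the representing object turns the supremum into an infimum. This expands
  members of a tensor product along dual bases, one variable at a time.\<close>

lemma representable_is_wsup:
  assumes "representable A \<phi>" "is_wsup A I w f z" "f \<in> I \<rightarrow> obj A"
  shows "\<phi> z = (INF i\<in>I. w i \<leadsto> \<phi> (f i))"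
proof -
  obtain x where "x \<in> obj A" "\<And>y. y \<in> obj A \<Longrightarrow> \<phi> y = hom A y x"
    using assms(1) by (auto simp: representable_def)
  then show ?thesis
    using assms(2,3) by (auto simp: is_wsup_def Pi_iff intro!: INF_cong)
qed

lemma is_wsup_hom:
  assumes "is_qcat A" "x \<in> obj A"
  shows "is_wsup A (obj A) (\<lambda>z. hom A z x) (\<lambda>z. z) x"
  using assms by (simp add: is_wsup_def hom_yoneda_INF)

text \<open>The adjoint functor theorem: at \<open>y\<close> the right adjoint is the supremum of
  all \<open>x\<close> weighted by \<open>hom B (F x) y\<close>.\<close>

lemma left_adjointI_wsup:
  assumes A: "QSup A" and B: "is_qcat B" and F: "\<And>x. x \<in> obj A \<Longrightarrow> F x \<in> obj B"
    and wsup: "\<And>w z. is_wsup A (obj A) w (\<lambda>x. x) z \<Longrightarrow> is_wsup B (obj A) w F (F z)"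
  shows "left_adjoint A B F"
proof -
  have "representable A (\<lambda>x. hom B (F x) y)" if y: "y \<in> obj B" for y
  proof -
    define w where "w x = hom B (F x) y" for x
    obtain z where z: "is_wsup A (obj A) w (\<lambda>x. x) z"
      using ex_is_wsup[OF A, of "\<lambda>x. x" "obj A"] by auto
    then have z_obj: "z \<in> obj A"
      by (simp add: is_wsup_def)
    have "1 \<le> hom A z z"
      using A z_obj by (simp add: qcat_refl)
    then have "w x \<le> hom A x z" if "x \<in> obj A" for x
      using z that by (simp add: is_wsup_def le_INF_iff)
    moreover have "hom A x z \<le> w x" if x: "x \<in> obj A" for x
    proof -
      \<comment> \<open>By preservation this becomes the counit
        \<open>1 \<le> hom B (F z) y\<close>; presenting \<open>z\<close> by its own representable
        then bounds \<open>hom A x z\<close>.\<close>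
      have "1 \<le> (INF x\<in>obj A. w x \<leadsto> hom B (F x) y)"
        by (simp add: w_def le_INF_iff)
      also have "\<dots> = hom B (F z) y"
        using wsup[OF z] y by (simp add: is_wsup_def)
      also have "\<dots> = (INF x\<in>obj A. hom A x z \<leadsto> hom B (F x) y)"
        using wsup[OF is_wsup_hom] A y z_obj by (simp add: is_wsup_def)
      finally show ?thesis
        using x by (simp add: le_INF_iff w_def)
    qed
    ultimately show ?thesis
      unfolding representable_def w_def using z_obj order.antisym by metis
  qed
  then show ?thesis
    using A B F by (simp add: left_adjoint_iff)
qed

lemma is_wsup_Q: "is_wsup Q_cat I w f (SUP i\<in>I. w i * f i)"
  by (simp add: is_wsup_def SUP_residual residual_residual)

lemma Q_cat_QSup [simp]: "QSup (Q_cat :: ('q::comm_unital_quantale, 'q) qcat)"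
  using is_wsup_Q by (intro QSupI Q_cat_qcat Q_cat_skeletal) blast

lemma left_adjoint_Q_SUP:
  assumes "left_adjoint A Q_cat g" "is_wsup A I w f z" "f \<in> I \<rightarrow> obj A"
  shows "g z = (SUP i\<in>I. w i * g (f i))"
  by (rule is_wsup_unique[OF Q_cat_qcat Q_cat_skeletal left_adjoint_is_wsup[OF assms] is_wsup_Q])

text \<open>The analogue of a dual basis of a projective module.\<close>

definition dual_basis ::
    "('a, 'q::comm_unital_quantale) qcat \<Rightarrow> 'i set \<Rightarrow> ('i \<Rightarrow> 'a \<Rightarrow> 'q) \<Rightarrow> ('i \<Rightarrow> 'a) \<Rightarrow> bool" where
  "dual_basis A I g e \<longleftrightarrow>
     (\<forall>i\<in>I. left_adjoint A Q_cat (g i)) \<and> e \<in> I \<rightarrow> obj A \<and>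
     (\<forall>a\<in>obj A. is_wsup A I (\<lambda>i. g i a) e a)"

text \<open>\<open>hom A a a\<close> is at least 1, and its expansion along the basis is an infimum
  of residuals, each of which is then at least 1 as well.\<close>

lemma coefficient_le:
  assumes "is_qcat A" "dual_basis A I g e" "i \<in> I" "a \<in> obj A"
  shows "g i a \<le> hom A (e i) a"
proof -
  have "1 \<le> (INF i\<in>I. g i a \<leadsto> hom A (e i) a)"
    using assms qcat_refl[of A a] by (simp add: dual_basis_def is_wsup_def)
  then show ?thesis
    using assms(3) by (simp add: le_INF_iff)
qed

lemma dual_basis_imp_ccd:
  assumes A: "QSup A" and basis: "dual_basis A I g e"
  shows "ccd A"
proof -
  define S where "S \<phi> = wsup A (obj A) \<phi> (\<lambda>x. x)" for \<phi>
  \<comment> \<open>The expansion of \<open>a\<close> along the basis, carried out with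
    representables in the presheaf category instead of objects of \<open>A\<close>.\<close>
  define T where "T a = (\<lambda>x\<in>obj A. SUP i\<in>I. g i a * hom A x (e i))" for a
  have S: "is_wsup A (obj A) \<phi> (\<lambda>x. x) (S \<phi>)" for \<phi>
    unfolding S_def using A by (intro is_wsup_wsup) auto
  then have S_obj: "S \<phi> \<in> obj A" for \<phi>
    by (simp add: is_wsup_def)
  have e: "e i \<in> obj A" if "i \<in> I" for i
    using basis that by (auto simp: dual_basis_def)
  have "adjoint A (presheaf_cat A) T S"
  proof (rule adjointI)
    show "T \<in> obj A \<rightarrow> obj (presheaf_cat A)"
      unfolding T_def using A e by (intro funcsetI SUP_presheaf) (auto intro: hom_presheaf)
    fix a \<phi> assume a: "a \<in> obj A" and \<phi>: "\<phi> \<in> obj (presheaf_cat A)"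
    have "hom (presheaf_cat A) (T a) \<phi> =
        (INF x\<in>obj A. (SUP i\<in>I. g i a * hom A x (e i)) \<leadsto> \<phi> x)"
      unfolding presheaf_cat_sel T_def by (intro INF_cong) auto
    also have "\<dots> = (INF i\<in>I. g i a \<leadsto> (INF x\<in>obj A. hom A x (e i) \<leadsto> \<phi> x))"
      by (rule INF_SUP_residual)
    also have "\<dots> = (INF i\<in>I. g i a \<leadsto> \<phi> (e i))"
      using A e \<phi> by (intro INF_cong) (auto simp: presheaf_INF_residual)
    also have "\<dots> = hom A a (S \<phi>)"
    proof (rule order.antisym)
      \<comment> \<open>\<open>S \<phi>\<close> is an upper bound, so
        \<open>\<phi> (e i) \<le> hom A (e i) (S \<phi>)\<close>, and the expansion of
        \<open>a\<close> gives the first inequality.\<close>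
      have "1 \<le> hom A (S \<phi>) (S \<phi>)"
        using A S_obj by (simp add: qcat_refl)
      then have "\<phi> x \<le> hom A x (S \<phi>)" if "x \<in> obj A" for x
        using S[of \<phi>] that by (simp add: is_wsup_def le_INF_iff)
      then have "(INF i\<in>I. g i a \<leadsto> \<phi> (e i)) \<le> (INF i\<in>I. g i a \<leadsto> hom A (e i) (S \<phi>))"
        using e by (intro INF_superset_mono) (auto intro!: residual_mono)
      also have "\<dots> = hom A a (S \<phi>)"
        using basis a S_obj by (simp add: dual_basis_def is_wsup_def)
      finally show "(INF i\<in>I. g i a \<leadsto> \<phi> (e i)) \<le> hom A a (S \<phi>)" .
      \<comment> \<open>For the second inequality, \<open>g i\<close> preserves the supremum
        \<open>S \<phi>\<close>, and each resulting term \<open>\<phi> x * g i x\<close> is at most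
        \<open>\<phi> (e i)\<close>.\<close>
      have "hom A a (S \<phi>) \<le> g i a \<leadsto> \<phi> (e i)" if i: "i \<in> I" for i
      proof -
        have g: "left_adjoint A Q_cat (g i)"
          using basis i by (simp add: dual_basis_def)
        have "\<phi> x * g i x \<le> \<phi> (e i)" if "x \<in> obj A" for x
        proof -
          have "\<phi> x * g i x \<le> \<phi> x * hom A (e i) x"
            using A basis i that by (intro quantale_mult_mono coefficient_le) auto
          also have "\<dots> \<le> \<phi> (e i)"
            using \<phi> e i that by (simp add: presheaf_cat_sel)
          finally show ?thesis .
        qed
        then have "g i (S \<phi>) \<le> \<phi> (e i)"
          using left_adjoint_Q_SUP[OF g S] by (simp add: SUP_le_iff)
        moreover have "hom A a (S \<phi>) \<le> g i a \<leadsto> g i (S \<phi>)"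
          using left_adjoint_hom_le[OF g a S_obj] by simp
        ultimately show ?thesis
          by (meson order.trans residual_mono)
      qed
      then show "hom A a (S \<phi>) \<le> (INF i\<in>I. g i a \<leadsto> \<phi> (e i))"
        by (rule INF_greatest)
    qed
    finally show "hom (presheaf_cat A) (T a) \<phi> = hom A a (S \<phi>)" .
  qed (use A S_obj presheaf_cat_qcat in auto)
  moreover have "adjoint (presheaf_cat A) A S (yoneda A)"
    using A S by (intro presheaf_adjoint_yoneda) auto
  ultimately show ?thesis
    unfolding ccd_def by blast
qed

text \<open>Evaluation at \<open>x\<close> has the right adjoint sending \<open>q\<close> to \<open>z \<mapsto> (hom A x z \<leadsto> q)\<close>.\<close>

lemma left_adjoint_presheaf_eval:
  assumes A: "is_qcat A" and x: "x \<in> obj A"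
  shows "left_adjoint (presheaf_cat A) Q_cat (\<lambda>\<phi>. \<phi> x)"
proof -
  have "representable (presheaf_cat A) (\<lambda>\<phi>. \<phi> x \<leadsto> q)" for q
    unfolding representable_def
  proof (intro bexI ballI)
    define \<zeta> where "\<zeta> = (\<lambda>z\<in>obj A. hom A x z \<leadsto> q)"
    have "(hom A x z \<leadsto> q) * hom A y z \<le> hom A x y \<leadsto> q" if "y \<in> obj A" "z \<in> obj A" for y z
    proof -
      have "(hom A x y * hom A y z) * (hom A x z \<leadsto> q) \<le> hom A x z * (hom A x z \<leadsto> q)"
        using A x that by (intro mult_mono_quantale qcat_trans) auto
      also have "\<dots> \<le> q"
        by (simp flip: le_residual_iff)
      finally show ?thesis
        by (simp add: le_residual_iff ac_simps)
    qed
    then show "\<zeta> \<in> obj (presheaf_cat A)"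
      by (simp add: presheaf_cat_sel \<zeta>_def)
    fix \<phi> assume \<phi>: "\<phi> \<in> obj (presheaf_cat A)"
    have "hom (presheaf_cat A) \<phi> \<zeta> = (INF z\<in>obj A. (\<phi> z * hom A x z) \<leadsto> q)"
      unfolding presheaf_cat_sel \<zeta>_def by (intro INF_cong) (auto simp: residual_residual)
    also have "\<dots> = (SUP z\<in>obj A. \<phi> z * hom A x z) \<leadsto> q"
      by (simp add: SUP_residual)
    \<comment> \<open>The co-Yoneda formula: the presheaf condition bounds all terms, and the term
      at \<open>z = x\<close> reaches the bound.\<close>
    also have "(SUP z\<in>obj A. \<phi> z * hom A x z) = \<phi> x"
    proof (rule order.antisym)
      show "(SUP z\<in>obj A. \<phi> z * hom A x z) \<le> \<phi> x"
        using \<phi> x by (auto simp: presheaf_cat_sel intro!: SUP_least)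
      have "\<phi> x * 1 \<le> \<phi> x * hom A x x"
        using A x by (intro quantale_mult_mono qcat_refl)
      also have "\<dots> \<le> (SUP z\<in>obj A. \<phi> z * hom A x z)"
        using x by (intro SUP_upper)
      finally show "\<phi> x \<le> (SUP z\<in>obj A. \<phi> z * hom A x z)"
        by simp
    qed
    finally show "\<phi> x \<leadsto> q = hom (presheaf_cat A) \<phi> \<zeta>" ..
  qed
  then show ?thesis
    by (simp add: left_adjoint_Q_iff presheaf_cat_qcat)
qed

text \<open>All objects together serve as basis, the coefficient of \<open>a\<close> at
  \<open>x\<close> being \<open>T a x\<close>. As a function of \<open>a\<close> it is
  \<open>T\<close> followed by evaluation at \<open>x\<close>, both of them left adjoints.\<close>

lemma ccd_imp_dual_basis:
  assumes A: "QSup A" and "ccd A"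
  shows "\<exists>g. dual_basis A (obj A) g (\<lambda>x. x)"
proof -
  obtain S T where S: "adjoint (presheaf_cat A) A S (yoneda A)" and T: "adjoint A (presheaf_cat A) T S"
    using assms(2) by (auto simp: ccd_def)
  have T_obj: "T a \<in> obj (presheaf_cat A)" if "a \<in> obj A" for a
    using T that by (auto simp: adjoint_def qfunctor_def)
  have S_obj: "S \<phi> \<in> obj A" if "\<phi> \<in> obj (presheaf_cat A)" for \<phi>
    using S that by (auto simp: adjoint_def qfunctor_def)
  have hom_S: "hom A (S \<phi>) y = hom (presheaf_cat A) \<phi> (yoneda A y)"
    if "\<phi> \<in> obj (presheaf_cat A)" "y \<in> obj A" for \<phi> y
    using S that by (simp add: adjoint_def)
  \<comment> \<open>The Yoneda embedding is fully faithful, so the counit is invertible, and by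
    skeletality it is an equality.\<close>
  have S_yoneda: "S (yoneda A y) = y" if y: "y \<in> obj A" for y
  proof (rule hom_left_eqI[OF QSup_qcat[OF A] QSup_skeletal[OF A]])
    fix z assume z: "z \<in> obj A"
    have "hom A (S (yoneda A y)) z = (INF x\<in>obj A. yoneda A y x \<leadsto> hom A x z)"
      using A y z by (simp add: hom_S yoneda_in_presheaf hom_presheaf_yoneda)
    also have "\<dots> = (INF x\<in>obj A. hom A x y \<leadsto> hom A x z)"
      by (intro INF_cong) (auto simp: yoneda_def)
    finally show "hom A (S (yoneda A y)) z = hom A y z"
      using A y z by (simp add: hom_yoneda_INF)
  qed (use A y in \<open>simp_all add: S_obj yoneda_in_presheaf\<close>)
  have "is_wsup A (obj A) (T a) (\<lambda>x. x) a" if a: "a \<in> obj A" for a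
  proof -
    have "hom A a y = (INF x\<in>obj A. T a x \<leadsto> hom A x y)" if y: "y \<in> obj A" for y
    proof -
      \<comment> \<open>Transposing along \<open>T\<close> and cancelling \<open>S\<close> against
        \<open>yoneda\<close> exhibits \<open>a\<close> as the supremum weighted by
        \<open>T a\<close>.\<close>
      have "hom A a (S (yoneda A y)) = hom (presheaf_cat A) (T a) (yoneda A y)"
        using T A a y yoneda_in_presheaf[of A y] by (simp add: adjoint_def)
      then show ?thesis
        using y by (simp add: S_yoneda hom_presheaf_yoneda)
    qed
    then show ?thesis
      using a by (simp add: is_wsup_def)
  qed
  moreover have "left_adjoint A Q_cat (\<lambda>a. T a x)" if "x \<in> obj A" for x
  proof (rule left_adjoint_comp[where G = "\<lambda>\<phi>. \<phi> x"])
    show "left_adjoint A (presheaf_cat A) T"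
      using T by (auto simp: left_adjoint_def)
    show "left_adjoint (presheaf_cat A) Q_cat (\<lambda>\<phi>. \<phi> x)"
      using A that by (simp add: left_adjoint_presheaf_eval)
  qed
  ultimately have "dual_basis A (obj A) (\<lambda>x a. T a x) (\<lambda>x. x)"
    by (simp add: dual_basis_def)
  then show ?thesis
    by (intro exI)
qed

lemma QSup_ccd_dual_basis:
  assumes "QSup_ccd A"
  obtains g where "dual_basis A (obj A) g (\<lambda>x. x)"
  using assms ccd_imp_dual_basis[of A] by (auto simp: QSup_ccd_def)

lemma QSup_ccdI: "QSup A \<Longrightarrow> dual_basis A I g e \<Longrightarrow> QSup_ccd A"
  by (simp add: QSup_ccd_def dual_basis_imp_ccd)

lemma QSup_ccd_QSup [simp]: "QSup_ccd A \<Longrightarrow> QSup A"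
  by (simp add: QSup_ccd_def)

text \<open>The unit alone is a basis: \<open>q\<close> is \<open>q * 1\<close>, with coefficient
  \<open>q\<close> itself.\<close>

lemma Q_cat_ccd [simp]: "QSup_ccd (Q_cat :: ('q::comm_unital_quantale, 'q) qcat)"
proof (rule QSup_ccdI)
  show "dual_basis (Q_cat :: ('q, 'q) qcat) {()} (\<lambda>_ q. q) (\<lambda>_. 1)"
    by (simp add: dual_basis_def is_wsup_def left_adjoint_id Q_cat_qcat)
qed simp


section \<open>Complete distributivity of the tensor product\<close>

lemma bimorphism_mult:
  assumes A: "QSup A" and B: "QSup B"
    and g: "left_adjoint A Q_cat g" and h: "left_adjoint B Q_cat h"
  shows "bimorphism A B Q_cat (\<lambda>(a, b). g a * h b)"
proof -
  \<comment> \<open>With one variable fixed, residuals out of the product are iterated residuals,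
    and representables are closed under residuation by the constant \<open>g a\<close>.\<close>
  have "representable B (\<lambda>b. g a \<leadsto> h b \<leadsto> q)" for a q
    using B h by (intro representable_residual) (simp_all add: left_adjoint_Q_iff)
  moreover have "representable A (\<lambda>a. h b \<leadsto> g a \<leadsto> q)" for b q
    using A g by (intro representable_residual) (simp_all add: left_adjoint_Q_iff)
  ultimately show ?thesis
    using A B by (simp add: bimorphism_iff residual_residual mult.commute[of "h _"])
qed

lemma dual_basis_tensor:
  assumes A: "QSup A" and B: "QSup B"
    and A_basis: "dual_basis A I g d" and B_basis: "dual_basis B J h e"
  shows "dual_basis (A \<otimes> B) (I \<times> J)
    (\<lambda>(i, j). tensor_lift A B Q_cat (\<lambda>(a, b). g i a * h j b)) (\<lambda>(i, j). pure_tensor A B (d i) (e j))"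
proof -
  let ?g = "\<lambda>i j. tensor_lift A B Q_cat (\<lambda>(a, b). g i a * h j b)"
  have bim: "bimorphism A B Q_cat (\<lambda>(a, b). g i a * h j b)" if "i \<in> I" "j \<in> J" for i j
    using A B A_basis B_basis that by (intro bimorphism_mult) (auto simp: dual_basis_def)
  have d: "d \<in> I \<rightarrow> obj A" and e: "e \<in> J \<rightarrow> obj B"
    using A_basis B_basis by (auto simp: dual_basis_def)
  have "is_wsup (A \<otimes> B) (I \<times> J) (\<lambda>(i, j). ?g i j \<psi>) (\<lambda>(i, j). pure_tensor A B (d i) (e j)) \<psi>"
    if \<psi>: "\<psi> \<in> obj (A \<otimes> B)" for \<psi>
    unfolding is_wsup_def
  proof (intro conjI ballI)
    fix \<chi> assume \<chi>: "\<chi> \<in> obj (A \<otimes> B)"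
    \<comment> \<open>Being representable in each variable, \<open>\<chi>\<close> turns the
      expansions of \<open>a\<close> and of \<open>b\<close> into infima.\<close>
    have \<chi>_expand: "\<chi> (a, b) = (INF (i, j)\<in>I \<times> J. (g i a * h j b) \<leadsto> \<chi> (d i, e j))"
      if a: "a \<in> obj A" and b: "b \<in> obj B" for a b
    proof -
      have "\<chi> (a, b) = (INF i\<in>I. g i a \<leadsto> \<chi> (d i, b))"
        using A_basis d \<chi> a b A B
        by (intro representable_is_wsup[of A "\<lambda>a. \<chi> (a, b)"])
          (auto simp: dual_basis_def obj_tensor_iff)
      also have "\<dots> = (INF i\<in>I. g i a \<leadsto> (INF j\<in>J. h j b \<leadsto> \<chi> (d i, e j)))"
      proof (rule INF_cong)
        fix i assume "i \<in> I"
        then have "\<chi> (d i, b) = (INF j\<in>J. h j b \<leadsto> \<chi> (d i, e j))"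
          using B_basis d e \<chi> b A B
          by (intro representable_is_wsup[of B "\<lambda>b. \<chi> (d i, b)"])
            (auto simp: dual_basis_def obj_tensor_iff)
        then show "g i a \<leadsto> \<chi> (d i, b) = g i a \<leadsto> (INF j\<in>J. h j b \<leadsto> \<chi> (d i, e j))"
          by simp
      qed simp
      also have "\<dots> = (INF (i, j)\<in>I \<times> J. (g i a * h j b) \<leadsto> \<chi> (d i, e j))"
        unfolding INF_Times residual_INF residual_residual ..
      finally show ?thesis .
    qed
    have "hom (A \<otimes> B) \<psi> \<chi> =
        (INF (a, b)\<in>obj A \<times> obj B. INF (i, j)\<in>I \<times> J. \<psi> (a, b) \<leadsto> (g i a * h j b) \<leadsto> \<chi> (d i, e j))"
      unfolding hom_tensor
      by (intro INF_cong) (auto simp: \<chi>_expand residual_INF case_prod_unfold)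
    \<comment> \<open>With the basis indices outside, the inner infimum is the hom in
      \<open>Q_cat\<close> from the coefficient of \<open>\<psi>\<close> to
      \<open>\<chi> (d i, e j)\<close>, by \<open>hom_tensor_lift\<close>.\<close>
    also have "\<dots> =
        (INF (i, j)\<in>I \<times> J. INF (a, b)\<in>obj A \<times> obj B. \<psi> (a, b) \<leadsto> (g i a * h j b) \<leadsto> \<chi> (d i, e j))"
      unfolding case_prod_unfold by (rule INF_commute)
    also have "\<dots> = (INF p\<in>I \<times> J. (case p of (i, j) \<Rightarrow> ?g i j \<psi>) \<leadsto>
        hom (A \<otimes> B) (case p of (i, j) \<Rightarrow> pure_tensor A B (d i) (e j)) \<chi>)"
    proof (rule INF_cong)
      fix p assume "p \<in> I \<times> J"
      then obtain i j where p: "p = (i, j)" "i \<in> I" "j \<in> J"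
        by auto
      then have obj: "d i \<in> obj A" "e j \<in> obj B"
        using d e by auto
      show "(case p of (i, j) \<Rightarrow>
          INF (a, b)\<in>obj A \<times> obj B. \<psi> (a, b) \<leadsto> (g i a * h j b) \<leadsto> \<chi> (d i, e j)) =
        (case p of (i, j) \<Rightarrow> ?g i j \<psi>) \<leadsto>
          hom (A \<otimes> B) (case p of (i, j) \<Rightarrow> pure_tensor A B (d i) (e j)) \<chi>"
        using hom_tensor_lift[OF A B Q_cat_QSup bim[OF p(2,3)] \<psi>] obj
        by (simp add: p hom_pure[OF \<chi>] case_prod_unfold)
    qed simp
    finally show "hom (A \<otimes> B) \<psi> \<chi> = (INF p\<in>I \<times> J. (case p of (i, j) \<Rightarrow> ?g i j \<psi>) \<leadsto>
        hom (A \<otimes> B) (case p of (i, j) \<Rightarrow> pure_tensor A B (d i) (e j)) \<chi>)" .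
  qed (fact \<psi>)
  moreover have "left_adjoint (A \<otimes> B) Q_cat (?g i j)" if "i \<in> I" "j \<in> J" for i j
    using A B bim[OF that] by (intro Mor_left_adjoint tensor_lift_Mor) auto
  ultimately show ?thesis
    using A B d e by (auto simp: dual_basis_def case_prod_unfold)
qed

lemma tensor_ccd [simp]:
  assumes A: "QSup_ccd A" and B: "QSup_ccd B"
  shows "QSup_ccd (A \<otimes> B)"
proof -
  obtain g h where "dual_basis A (obj A) g (\<lambda>a. a)" "dual_basis B (obj B) h (\<lambda>b. b)"
    using A B QSup_ccd_dual_basis by metis
  then have "dual_basis (A \<otimes> B) (obj A \<times> obj B)
    (\<lambda>(i, j). tensor_lift A B Q_cat (\<lambda>(a, b). g i a * h j b)) (\<lambda>(i, j). pure_tensor A B i j)"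
    using A B by (intro dual_basis_tensor) auto
  then show ?thesis
    using A B by (intro QSup_ccdI[of "A \<otimes> B"]) auto
qed


section \<open>Internal homs\<close>

lemma internal_hom_sel [simp]:
  "obj (internal_hom A B) = Mor A B"
  "hom (internal_hom A B) F G = (INF x\<in>obj A. hom B (F x) (G x))"
  by (simp_all add: internal_hom_def)

lemma representable_Mor:
  "is_qcat A \<Longrightarrow> is_qcat B \<Longrightarrow> F \<in> Mor A B \<Longrightarrow> y \<in> obj B \<Longrightarrow> representable A (\<lambda>x. hom B (F x) y)"
  using Mor_left_adjoint[of F A B] by (simp add: left_adjoint_iff)

text \<open>Representables are closed under weighted infima, so pointwise suprema of left adjoints
  are left adjoints.\<close>

lemma wsup_in_Mor:
  assumes A: "QSup A" and B: "QSup B" and F: "\<And>i. i \<in> I \<Longrightarrow> F i \<in> Mor A B"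
  shows "(\<lambda>a\<in>obj A. wsup B I w (\<lambda>i. F i a)) \<in> Mor A B"
proof (rule restrict_Mor)
  have obj: "(\<lambda>i. F i a) \<in> I \<rightarrow> obj B" if "a \<in> obj A" for a
    using Mor_in_obj[OF F] that by auto
  have "representable A (\<lambda>a. hom B (wsup B I w (\<lambda>i. F i a)) y)" if y: "y \<in> obj B" for y
  proof -
    have "representable A (\<lambda>a. INF i\<in>I. w i \<leadsto> hom B (F i a) y)"
      using A B F y by (intro representable_INF) (auto intro: representable_Mor)
    then show ?thesis
      using representable_cong[of A "\<lambda>a. hom B (wsup B I w (\<lambda>i. F i a)) y"] hom_wsup[OF B obj y] by simp
  qed
  then show "left_adjoint A B (\<lambda>a. wsup B I w (\<lambda>i. F i a))"
    using A B obj by (simp add: left_adjoint_iff)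
qed

lemma is_wsup_internal_hom:
  assumes A: "QSup A" and B: "QSup B" and F: "\<And>i. i \<in> I \<Longrightarrow> F i \<in> Mor A B"
  shows "is_wsup (internal_hom A B) I w F (\<lambda>a\<in>obj A. wsup B I w (\<lambda>i. F i a))"
  unfolding is_wsup_def internal_hom_sel
proof (intro conjI ballI)
  show "(\<lambda>a\<in>obj A. wsup B I w (\<lambda>i. F i a)) \<in> Mor A B"
    using assms by (rule wsup_in_Mor)
  fix G assume G: "G \<in> Mor A B"
  have "(INF a\<in>obj A. hom B ((\<lambda>a\<in>obj A. wsup B I w (\<lambda>i. F i a)) a) (G a)) =
      (INF a\<in>obj A. INF i\<in>I. w i \<leadsto> hom B (F i a) (G a))"
    using Mor_in_obj[OF F] Mor_in_obj[OF G] by (intro INF_cong) (auto simp: hom_wsup[OF B] Pi_iff)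
  also have "\<dots> = (INF i\<in>I. w i \<leadsto> (INF a\<in>obj A. hom B (F i a) (G a)))"
    unfolding residual_INF by (rule INF_commute)
  finally show "(INF a\<in>obj A. hom B ((\<lambda>a\<in>obj A. wsup B I w (\<lambda>i. F i a)) a) (G a)) =
      (INF i\<in>I. w i \<leadsto> (INF a\<in>obj A. hom B (F i a) (G a)))" .
qed

lemma internal_hom_QSup [simp]:
  assumes "QSup A" "QSup B"
  shows "QSup (internal_hom A B)"
proof (rule QSupI)
  show "is_qcat (internal_hom A B)"
    unfolding internal_hom_def using assms by (intro pointwise_qcat) auto
  show "skeletal (internal_hom A B)"
    unfolding internal_hom_def using assms
    by (intro pointwise_skeletal) (auto simp: Mor_def left_adjoint_in_obj)
  show "\<exists>z. is_wsup (internal_hom A B) (obj (internal_hom A B)) w (\<lambda>x. x) z" for w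
    using is_wsup_internal_hom[OF assms, of "Mor A B" "\<lambda>F. F" w] by auto
qed

text \<open>Suprema of morphisms are pointwise and unique, hence preserved by evaluation, and the
  adjoint functor theorem \<open>left_adjointI_wsup\<close> applies.\<close>

lemma left_adjoint_eval:
  assumes A: "QSup A" and B: "QSup B" and a: "a \<in> obj A"
  shows "left_adjoint (internal_hom A B) B (\<lambda>F. F a)"
proof (rule left_adjointI_wsup)
  fix w G assume G: "is_wsup (internal_hom A B) (obj (internal_hom A B)) w (\<lambda>x. x) G"
  have "is_wsup (internal_hom A B) (Mor A B) w (\<lambda>F. F) (\<lambda>a\<in>obj A. wsup B (Mor A B) w (\<lambda>F. F a))"
    using A B by (intro is_wsup_internal_hom) auto
  then have "G = (\<lambda>a\<in>obj A. wsup B (Mor A B) w (\<lambda>F. F a))"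
    using A B G by (intro is_wsup_unique[of "internal_hom A B" "Mor A B" w]) auto
  moreover have "is_wsup B (Mor A B) w (\<lambda>F. F a) (wsup B (Mor A B) w (\<lambda>F. F a))"
    using B a by (intro is_wsup_wsup) auto
  ultimately show "is_wsup B (obj (internal_hom A B)) w (\<lambda>F. F a) (G a)"
    using a by simp
qed (use A B a in auto)

lemma dual_basis_internal_hom:
  assumes A: "QSup A" and B: "QSup B"
    and A_basis: "dual_basis A I g d" and B_basis: "dual_basis B J h e"
  shows "dual_basis (internal_hom A B) (I \<times> J) (\<lambda>(i, j) F. h j (F (d i)))
    (\<lambda>(i, j). \<lambda>a\<in>obj A. wsup B {()} (\<lambda>_. g i a) (\<lambda>_. e j))"
proof -
  \<comment> \<open>The object \<open>g i a \<cdot> e j\<close>, written as a supremum over one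
    index.\<close>
  define E where "E i j a = wsup B {()} (\<lambda>_. g i a) (\<lambda>_. e j)" for i j a
  have g: "left_adjoint A Q_cat (g i)" if "i \<in> I" for i
    using A_basis that by (simp add: dual_basis_def)
  have h: "left_adjoint B Q_cat (h j)" if "j \<in> J" for j
    using B_basis that by (simp add: dual_basis_def)
  have d: "d \<in> I \<rightarrow> obj A" and e: "e \<in> J \<rightarrow> obj B"
    using A_basis B_basis by (auto simp: dual_basis_def)
  have E_obj: "E i j a \<in> obj B" if "j \<in> J" for i j a
    using e that unfolding E_def by (intro wsup_in_obj[OF B]) auto
  have hom_E: "hom B (E i j a) y = g i a \<leadsto> hom B (e j) y" if "j \<in> J" "y \<in> obj B" for i j a y
    using hom_wsup[OF B, of "\<lambda>_. e j" "{()}" y "\<lambda>_. g i a"] e that by (auto simp: E_def)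
  \<comment> \<open>By \<open>hom_E\<close> this asks for representability of
    \<open>g i - \<leadsto> q\<close>, which is the left adjointness of \<open>g i\<close>.\<close>
  have E: "left_adjoint A B (E i j)" if "i \<in> I" "j \<in> J" for i j
    using A B g E_obj that by (simp add: left_adjoint_iff hom_E)
  have "is_wsup (internal_hom A B) (I \<times> J) (\<lambda>(i, j). h j (F (d i)))
      (\<lambda>(i, j). restrict (E i j) (obj A)) F" if F: "F \<in> Mor A B" for F
    unfolding is_wsup_def internal_hom_sel
  proof (intro conjI ballI)
    fix G assume G: "G \<in> Mor A B"
    have "(INF a\<in>obj A. hom B (F a) (G a)) =
        (INF a\<in>obj A. INF p\<in>I \<times> J. h (snd p) (F (d (fst p))) \<leadsto> hom B (E (fst p) (snd p) a) (G a))"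
    proof (rule INF_cong)
      fix a assume a: "a \<in> obj A"
      \<comment> \<open>\<open>F\<close> preserves the expansion of \<open>a\<close>; each
        \<open>F (d i)\<close> is then expanded in \<open>B\<close>.\<close>
      have "hom B (F a) (G a) = (INF i\<in>I. g i a \<leadsto> hom B (F (d i)) (G a))"
        using left_adjoint_is_wsup[OF Mor_left_adjoint[OF F], of I "\<lambda>i. g i a" d a] A_basis a d G
        by (auto simp: dual_basis_def is_wsup_def)
      also have "\<dots> = (INF i\<in>I. g i a \<leadsto> (INF j\<in>J. h j (F (d i)) \<leadsto> hom B (e j) (G a)))"
      proof (rule INF_cong)
        fix i assume "i \<in> I"
        then have "is_wsup B J (\<lambda>j. h j (F (d i))) e (F (d i))"
          using B_basis Mor_in_obj[OF F funcset_mem[OF d]] by (simp add: dual_basis_def)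
        then show "g i a \<leadsto> hom B (F (d i)) (G a) =
            g i a \<leadsto> (INF j\<in>J. h j (F (d i)) \<leadsto> hom B (e j) (G a))"
          using a G by (simp add: is_wsup_def)
      qed simp
      \<comment> \<open>The two coefficients trade places, which turns
        \<open>g i a \<leadsto> hom B (e j) (G a)\<close> into the hom out of
        \<open>E i j a\<close>.\<close>
      also have "\<dots> = (INF i\<in>I. INF j\<in>J. h j (F (d i)) \<leadsto> hom B (E i j a) (G a))"
        using a G by (intro INF_cong) (auto simp: residual_INF hom_E residual_left_commute intro!: INF_cong)
      also have "\<dots> =
          (INF p\<in>I \<times> J. h (snd p) (F (d (fst p))) \<leadsto> hom B (E (fst p) (snd p) a) (G a))"
        by (simp add: INF_Times[symmetric] case_prod_unfold)
      finally show "hom B (F a) (G a) = \<dots>" .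
    qed simp
    also have "\<dots> = (INF p\<in>I \<times> J. h (snd p) (F (d (fst p))) \<leadsto>
        (INF a\<in>obj A. hom B (E (fst p) (snd p) a) (G a)))"
      unfolding residual_INF by (rule INF_commute)
    finally show "(INF a\<in>obj A. hom B (F a) (G a)) =
      (INF p\<in>I \<times> J. (case p of (i, j) \<Rightarrow> h j (F (d i))) \<leadsto>
        (INF a\<in>obj A. hom B ((case p of (i, j) \<Rightarrow> restrict (E i j) (obj A)) a) (G a)))"
      by (simp add: case_prod_unfold)
  qed (fact F)
  moreover have "left_adjoint (internal_hom A B) Q_cat (\<lambda>F. h j (F (d i)))" if "i \<in> I" "j \<in> J" for i j
  proof (rule left_adjoint_comp[where F = "\<lambda>F. F (d i)"])
    show "left_adjoint (internal_hom A B) B (\<lambda>F. F (d i))"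
      using A B d that by (intro left_adjoint_eval) auto
  qed (use h that in auto)
  ultimately have "dual_basis (internal_hom A B) (I \<times> J) (\<lambda>(i, j) F. h j (F (d i)))
      (\<lambda>(i, j). restrict (E i j) (obj A))"
    using E by (auto simp: dual_basis_def case_prod_unfold restrict_Mor)
  then show ?thesis
    by (simp add: E_def[abs_def])
qed

lemma internal_hom_ccd [simp]:
  assumes A: "QSup_ccd A" and B: "QSup_ccd B"
  shows "QSup_ccd (internal_hom A B)"
proof -
  obtain g h where "dual_basis A (obj A) g (\<lambda>a. a)" "dual_basis B (obj B) h (\<lambda>b. b)"
    using A B QSup_ccd_dual_basis by metis
  then show ?thesis
    using A B by (intro QSup_ccdI[OF _ dual_basis_internal_hom]) auto
qed


section \<open>Structure maps\<close>

lemma Mor_idm [simp]: "is_qcat A \<Longrightarrow> idm A \<in> Mor A A"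
  unfolding idm_def by (intro restrict_Mor left_adjoint_id)

lemma idm_apply [simp]: "x \<in> obj A \<Longrightarrow> idm A x = x"
  by (simp add: idm_def)

lemma Mor_comp: "F \<in> Mor A B \<Longrightarrow> G \<in> Mor B C \<Longrightarrow> mcomp A G F \<in> Mor A C"
  unfolding compose_def by (intro restrict_Mor left_adjoint_comp[of A B F C G] Mor_left_adjoint)

lemma Mor_extensional: "F \<in> Mor A B \<Longrightarrow> F \<in> extensional (obj A)"
  by (simp add: Mor_def)

lemma is_isoI:
  "F \<in> Mor A B \<Longrightarrow> G \<in> Mor B A \<Longrightarrow> mcomp A G F = idm A \<Longrightarrow> mcomp B F G = idm B \<Longrightarrow> is_iso A B F"
  unfolding is_iso_def by (intro conjI bexI)

section \<open>Equality of morphisms tested on pure tensors\<close>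

lemma tensor_Mor_eqI:
  assumes AB: "QSup A" "QSup B" and C: "QSup C"
    and F: "F \<in> Mor (A \<otimes> B) C" and F': "F' \<in> Mor (A \<otimes> B) C"
    and eq: "\<And>a b. a \<in> obj A \<Longrightarrow> b \<in> obj B \<Longrightarrow> F (pure_tensor A B a b) = F' (pure_tensor A B a b)"
  shows "F = F'"
  using F F'
proof (rule Mor_eqI)
  show "F \<psi> = F' \<psi>" if "\<psi> \<in> obj (A \<otimes> B)" for \<psi>
    by (rule tensor_eqI[OF AB QSup_qcat[OF C] QSup_skeletal[OF C] _ _ _ that])
      (use F F' eq in \<open>simp_all add: Mor_left_adjoint\<close>)
qed

lemma left_adjoint_bimorphism_left: "bimorphism A B C f \<Longrightarrow> b \<in> obj B \<Longrightarrow> left_adjoint A C (\<lambda>a. f (a, b))"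
  and left_adjoint_bimorphism_right: "bimorphism A B C f \<Longrightarrow> a \<in> obj A \<Longrightarrow> left_adjoint B C (\<lambda>b. f (a, b))"
  by (simp_all add: bimorphism_def)

lemma left_adjoint_pure_left:
  "QSup A \<Longrightarrow> QSup B \<Longrightarrow> b \<in> obj B \<Longrightarrow> left_adjoint A (A \<otimes> B) (\<lambda>a. pure_tensor A B a b)"
  using left_adjoint_bimorphism_left[OF bimorphism_pure] by fastforce

lemma left_adjoint_pure_right:
  "QSup A \<Longrightarrow> QSup B \<Longrightarrow> a \<in> obj A \<Longrightarrow> left_adjoint B (A \<otimes> B) (\<lambda>b. pure_tensor A B a b)"
  using left_adjoint_bimorphism_right[OF bimorphism_pure] by fastforce

lemma left_adjoint_pure_comp_left:
  "QSup A \<Longrightarrow> QSup B \<Longrightarrow> left_adjoint (A \<otimes> B) C F \<Longrightarrow> b \<in> obj B \<Longrightarrow>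
    left_adjoint A C (\<lambda>a. F (pure_tensor A B a b))"
  by (rule left_adjoint_comp[of A "A \<otimes> B" "\<lambda>a. pure_tensor A B a b" C F]) (rule left_adjoint_pure_left)

lemma left_adjoint_pure_comp_right:
  "QSup A \<Longrightarrow> QSup B \<Longrightarrow> left_adjoint (A \<otimes> B) C F \<Longrightarrow> a \<in> obj A \<Longrightarrow>
    left_adjoint B C (\<lambda>b. F (pure_tensor A B a b))"
  by (rule left_adjoint_comp[of B "A \<otimes> B" "\<lambda>b. pure_tensor A B a b" C F]) (rule left_adjoint_pure_right)

text \<open>For fixed \<open>c\<close> both sides are left adjoint in \<open>t\<close>, so agreement
  on the pure tensors of \<open>A \<otimes> B\<close> spreads to every \<open>t\<close>, and from
  there to the whole product.\<close>

lemma tensor3_Mor_eqI: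
  assumes ABC: "QSup A" "QSup B" "QSup C" and D: "QSup D"
    and F: "F \<in> Mor ((A \<otimes> B) \<otimes> C) D" and F': "F' \<in> Mor ((A \<otimes> B) \<otimes> C) D"
    and eq: "\<And>a b c. a \<in> obj A \<Longrightarrow> b \<in> obj B \<Longrightarrow> c \<in> obj C \<Longrightarrow>
      F (pure_tensor (A \<otimes> B) C (pure_tensor A B a b) c) = F' (pure_tensor (A \<otimes> B) C (pure_tensor A B a b) c)"
  shows "F = F'"
proof (rule tensor_Mor_eqI[OF tensor_QSup[OF ABC(1,2)] ABC(3) D F F'])
  fix t c assume t: "t \<in> obj (A \<otimes> B)" and c: "c \<in> obj C"
  show "F (pure_tensor (A \<otimes> B) C t c) = F' (pure_tensor (A \<otimes> B) C t c)"
    by (rule tensor_eqI[OF ABC(1,2) QSup_qcat[OF D] QSup_skeletal[OF D] _ _ _ t])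
      (use ABC F F' c in \<open>auto intro: left_adjoint_pure_comp_left Mor_left_adjoint eq\<close>)
qed

lemma tensor3_right_Mor_eqI:
  assumes ABC: "QSup A" "QSup B" "QSup C" and D: "QSup D"
    and F: "F \<in> Mor (A \<otimes> (B \<otimes> C)) D" and F': "F' \<in> Mor (A \<otimes> (B \<otimes> C)) D"
    and eq: "\<And>a b c. a \<in> obj A \<Longrightarrow> b \<in> obj B \<Longrightarrow> c \<in> obj C \<Longrightarrow>
      F (pure_tensor A (B \<otimes> C) a (pure_tensor B C b c)) = F' (pure_tensor A (B \<otimes> C) a (pure_tensor B C b c))"
  shows "F = F'"
proof (rule tensor_Mor_eqI[OF ABC(1) tensor_QSup[OF ABC(2,3)] D F F'])
  fix a t assume a: "a \<in> obj A" and t: "t \<in> obj (B \<otimes> C)"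
  show "F (pure_tensor A (B \<otimes> C) a t) = F' (pure_tensor A (B \<otimes> C) a t)"
    by (rule tensor_eqI[OF ABC(2,3) QSup_qcat[OF D] QSup_skeletal[OF D] _ _ _ t])
      (use ABC F F' a in \<open>auto intro: left_adjoint_pure_comp_right Mor_left_adjoint eq\<close>)
qed

text \<open>The case of three factors, with \<open>A \<otimes> B\<close> as the first, leaves an
  arbitrary \<open>t\<close> in \<open>A \<otimes> B\<close>, which is reduced to pure tensors once
  more.\<close>

lemma tensor4_Mor_eqI:
  assumes ABCD: "QSup A" "QSup B" "QSup C" "QSup D" and E: "QSup E"
    and F: "F \<in> Mor (((A \<otimes> B) \<otimes> C) \<otimes> D) E" and F': "F' \<in> Mor (((A \<otimes> B) \<otimes> C) \<otimes> D) E"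
    and eq: "\<And>a b c d. a \<in> obj A \<Longrightarrow> b \<in> obj B \<Longrightarrow> c \<in> obj C \<Longrightarrow> d \<in> obj D \<Longrightarrow>
      F (pure_tensor ((A \<otimes> B) \<otimes> C) D (pure_tensor (A \<otimes> B) C (pure_tensor A B a b) c) d) =
      F' (pure_tensor ((A \<otimes> B) \<otimes> C) D (pure_tensor (A \<otimes> B) C (pure_tensor A B a b) c) d)"
  shows "F = F'"
proof (rule tensor3_Mor_eqI[OF tensor_QSup[OF ABCD(1,2)] ABCD(3,4) E F F'])
  fix t c d assume t: "t \<in> obj (A \<otimes> B)" and c: "c \<in> obj C" and d: "d \<in> obj D"
  have *: "left_adjoint (A \<otimes> B) E (\<lambda>t. H (pure_tensor ((A \<otimes> B) \<otimes> C) D (pure_tensor (A \<otimes> B) C t c) d))"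
    if "H \<in> Mor (((A \<otimes> B) \<otimes> C) \<otimes> D) E" for H
    using ABCD c d Mor_left_adjoint[OF that]
    by (intro left_adjoint_pure_comp_left[of "A \<otimes> B" C E "\<lambda>t. H (pure_tensor ((A \<otimes> B) \<otimes> C) D t d)"]
        left_adjoint_pure_comp_left[of "(A \<otimes> B) \<otimes> C" D E H]) auto
  show "F (pure_tensor ((A \<otimes> B) \<otimes> C) D (pure_tensor (A \<otimes> B) C t c) d) =
      F' (pure_tensor ((A \<otimes> B) \<otimes> C) D (pure_tensor (A \<otimes> B) C t c) d)"
    by (rule tensor_eqI[OF ABCD(1,2) QSup_qcat[OF E] QSup_skeletal[OF E] *[OF F] *[OF F'] _ t])
      (use c d in \<open>auto intro: eq\<close>)
qed

section \<open>Tensor product of morphisms and braiding\<close>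

lemma bimorphism_comp:
  assumes "bimorphism A1 B1 C f" "F \<in> Mor A A1" "G \<in> Mor B B1"
  shows "bimorphism A B C (\<lambda>(a, b). f (F a, G b))"
  unfolding bimorphism_def prod.case
proof (intro conjI ballI)
  fix a assume "a \<in> obj A"
  then have "left_adjoint B1 C (\<lambda>b. f (F a, b))"
    using assms by (auto simp: bimorphism_def)
  then show "left_adjoint B C (\<lambda>b. f (F a, G b))"
    using left_adjoint_comp[OF Mor_left_adjoint[OF assms(3)]] by fast
next
  fix b assume "b \<in> obj B"
  then have "left_adjoint A1 C (\<lambda>a. f (a, G b))"
    using assms by (auto simp: bimorphism_def)
  then show "left_adjoint A C (\<lambda>a. f (F a, G b))"
    using left_adjoint_comp[OF Mor_left_adjoint[OF assms(2)]] by fast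
qed

lemma
  assumes "QSup A" "QSup B" "QSup A1" "QSup B1" "F \<in> Mor A A1" "G \<in> Mor B B1"
  shows tensor_map_Mor: "tensor_map A A1 B B1 F G \<in> Mor (A \<otimes> B) (A1 \<otimes> B1)"
    and tensor_map_pure: "a \<in> obj A \<Longrightarrow> b \<in> obj B \<Longrightarrow>
      tensor_map A A1 B B1 F G (pure_tensor A B a b) = pure_tensor A1 B1 (F a) (G b)"
proof -
  have "bimorphism A B (A1 \<otimes> B1) (\<lambda>(a, b). pure_tensor A1 B1 (F a) (G b))"
    using bimorphism_comp[OF bimorphism_pure assms(5,6)] assms by simp
  then show "tensor_map A A1 B B1 F G \<in> Mor (A \<otimes> B) (A1 \<otimes> B1)"
    and "a \<in> obj A \<Longrightarrow> b \<in> obj B \<Longrightarrow>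
      tensor_map A A1 B B1 F G (pure_tensor A B a b) = pure_tensor A1 B1 (F a) (G b)"
    using assms by (simp_all add: tensor_map_def tensor_lift_Mor tensor_lift_pure)
qed

lemma bimorphism_swap: "bimorphism A B C f \<Longrightarrow> bimorphism B A C (\<lambda>(b, a). f (a, b))"
  by (simp add: bimorphism_def)

lemma
  assumes "QSup A" "QSup B"
  shows braiding_Mor: "braiding A B \<in> Mor (A \<otimes> B) (B \<otimes> A)"
    and braiding_pure: "a \<in> obj A \<Longrightarrow> b \<in> obj B \<Longrightarrow>
      braiding A B (pure_tensor A B a b) = pure_tensor B A b a"
proof -
  have "bimorphism A B (B \<otimes> A) (\<lambda>(a, b). pure_tensor B A b a)"
    using bimorphism_swap[OF bimorphism_pure] assms by simp
  then show "braiding A B \<in> Mor (A \<otimes> B) (B \<otimes> A)"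
    and "a \<in> obj A \<Longrightarrow> b \<in> obj B \<Longrightarrow> braiding A B (pure_tensor A B a b) = pure_tensor B A b a"
    using assms by (simp_all add: braiding_def tensor_lift_Mor tensor_lift_pure)
qed

lemma braiding_braiding:
  assumes "QSup A" "QSup B"
  shows "mcomp (A \<otimes> B) (braiding B A) (braiding A B) = idm (A \<otimes> B)"
proof (rule tensor_Mor_eqI)
  show "mcomp (A \<otimes> B) (braiding B A) (braiding A B) \<in> Mor (A \<otimes> B) (A \<otimes> B)"
    by (rule Mor_comp[of _ _ "B \<otimes> A"]) (use assms in \<open>simp_all add: braiding_Mor\<close>)
qed (use assms in \<open>simp_all add: compose_eq braiding_pure\<close>)

lemma braiding_iso:
  assumes "QSup A" "QSup B"
  shows "is_iso (A \<otimes> B) (B \<otimes> A) (braiding A B)"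
  by (rule is_isoI[OF braiding_Mor braiding_Mor braiding_braiding braiding_braiding]) (use assms in auto)

section \<open>Trimorphisms and the associator\<close>

lemma ex_trimorphism_lift:
  assumes A: "QSup A" and B: "QSup B" and C: "QSup C" and D: "QSup D"
    and fA: "\<And>b c. b \<in> obj B \<Longrightarrow> c \<in> obj C \<Longrightarrow> left_adjoint A D (\<lambda>a. f a b c)"
    and fB: "\<And>a c. a \<in> obj A \<Longrightarrow> c \<in> obj C \<Longrightarrow> left_adjoint B D (\<lambda>b. f a b c)"
    and fC: "\<And>a b. a \<in> obj A \<Longrightarrow> b \<in> obj B \<Longrightarrow> left_adjoint C D (\<lambda>c. f a b c)"
  shows "\<exists>h. h \<in> Mor ((A \<otimes> B) \<otimes> C) D \<and> (\<forall>a\<in>obj A. \<forall>b\<in>obj B. \<forall>c\<in>obj C.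
    h (pure_tensor (A \<otimes> B) C (pure_tensor A B a b) c) = f a b c)"
proof -
  have bim: "bimorphism A B D (\<lambda>(a, b). f a b c)" if "c \<in> obj C" for c
    using fA fB that by (simp add: bimorphism_def)
  \<comment> \<open>For fixed \<open>c\<close> the map extends over \<open>A \<otimes> B\<close>;
    what remains is that the extension is still left adjoint in \<open>c\<close>.\<close>
  define k where "k t c = tensor_lift A B D (\<lambda>(a, b). f a b c) t" for t c
  have k: "left_adjoint (A \<otimes> B) D (\<lambda>t. k t c)" if "c \<in> obj C" for c
    unfolding k_def using A B D bim[OF that] by (intro Mor_left_adjoint tensor_lift_Mor)
  have "left_adjoint C D (k t)" if t: "t \<in> obj (A \<otimes> B)" for t
  proof -
    have "representable C (\<lambda>c. hom D (k t c) y)" if y: "y \<in> obj D" for y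
    proof -
      \<comment> \<open>By \<open>hom_tensor_lift\<close>, \<open>hom D (k t c) y\<close> is a
        weighted infimum of presheaves representable in \<open>c\<close>.\<close>
      have "representable C (\<lambda>c. INF p\<in>obj A \<times> obj B. t p \<leadsto> hom D (f (fst p) (snd p) c) y)"
        using C D fC y by (intro representable_INF) (auto simp: left_adjoint_iff)
      moreover have "hom D (k t c) y = (INF p\<in>obj A \<times> obj B. t p \<leadsto> hom D (f (fst p) (snd p) c) y)"
        if "c \<in> obj C" for c
        using hom_tensor_lift[OF A B D bim[OF that] t y] by (simp add: k_def case_prod_unfold)
      ultimately show ?thesis
        using representable_cong[of C "\<lambda>c. hom D (k t c) y"] by simp
    qed
    moreover have "k t \<in> obj C \<rightarrow> obj D"
      using left_adjoint_in_obj[OF k t] by simp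
    ultimately show ?thesis
      using C D by (simp add: left_adjoint_iff)
  qed
  then have bim_k: "bimorphism (A \<otimes> B) C D (\<lambda>(t, c). k t c)"
    using k by (simp add: bimorphism_def)
  show ?thesis
  proof (intro exI conjI ballI)
    show "tensor_lift (A \<otimes> B) C D (\<lambda>(t, c). k t c) \<in> Mor ((A \<otimes> B) \<otimes> C) D"
      using A B C D bim_k by (intro tensor_lift_Mor) auto
    show "tensor_lift (A \<otimes> B) C D (\<lambda>(t, c). k t c) (pure_tensor (A \<otimes> B) C (pure_tensor A B a b) c) = f a b c"
      if "a \<in> obj A" "b \<in> obj B" "c \<in> obj C" for a b c
      using A B C D bim_k bim that by (simp add: tensor_lift_pure k_def)
  qed
qed

text \<open>The triple pure tensor is left adjoint in each variable, so it extends; agreement on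
  pure tensors gives the uniqueness that the definite description demands.\<close>

lemma
  assumes A: "QSup A" and B: "QSup B" and C: "QSup C"
  shows associator_Mor: "associator A B C \<in> Mor ((A \<otimes> B) \<otimes> C) (A \<otimes> (B \<otimes> C))"
    and associator_pure: "\<And>a b c. a \<in> obj A \<Longrightarrow> b \<in> obj B \<Longrightarrow> c \<in> obj C \<Longrightarrow>
      associator A B C (pure_tensor (A \<otimes> B) C (pure_tensor A B a b) c) =
      pure_tensor A (B \<otimes> C) a (pure_tensor B C b c)"
proof -
  have "\<exists>h. h \<in> Mor ((A \<otimes> B) \<otimes> C) (A \<otimes> (B \<otimes> C)) \<and> (\<forall>a\<in>obj A. \<forall>b\<in>obj B. \<forall>c\<in>obj C.
      h (pure_tensor (A \<otimes> B) C (pure_tensor A B a b) c) = pure_tensor A (B \<otimes> C) a (pure_tensor B C b c))"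
    using A B C
    by (intro ex_trimorphism_lift left_adjoint_pure_left left_adjoint_pure_comp_left
        left_adjoint_pure_comp_right left_adjoint_pure_right) auto
  then have "\<exists>!h. h \<in> Mor ((A \<otimes> B) \<otimes> C) (A \<otimes> (B \<otimes> C)) \<and> (\<forall>a\<in>obj A. \<forall>b\<in>obj B. \<forall>c\<in>obj C.
      h (pure_tensor (A \<otimes> B) C (pure_tensor A B a b) c) = pure_tensor A (B \<otimes> C) a (pure_tensor B C b c))"
  proof (rule ex_ex1I)
    fix h h'
    assume "h \<in> Mor ((A \<otimes> B) \<otimes> C) (A \<otimes> (B \<otimes> C)) \<and> (\<forall>a\<in>obj A. \<forall>b\<in>obj B. \<forall>c\<in>obj C.
        h (pure_tensor (A \<otimes> B) C (pure_tensor A B a b) c) = pure_tensor A (B \<otimes> C) a (pure_tensor B C b c))"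
      and "h' \<in> Mor ((A \<otimes> B) \<otimes> C) (A \<otimes> (B \<otimes> C)) \<and> (\<forall>a\<in>obj A. \<forall>b\<in>obj B. \<forall>c\<in>obj C.
        h' (pure_tensor (A \<otimes> B) C (pure_tensor A B a b) c) = pure_tensor A (B \<otimes> C) a (pure_tensor B C b c))"
    then show "h = h'"
      using A B C by (intro tensor3_Mor_eqI[of A B C "A \<otimes> (B \<otimes> C)"]) simp_all
  qed
  from theI'[OF this]
  show "associator A B C \<in> Mor ((A \<otimes> B) \<otimes> C) (A \<otimes> (B \<otimes> C))"
    and "\<And>a b c. a \<in> obj A \<Longrightarrow> b \<in> obj B \<Longrightarrow> c \<in> obj C \<Longrightarrow>
      associator A B C (pure_tensor (A \<otimes> B) C (pure_tensor A B a b) c) =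
      pure_tensor A (B \<otimes> C) a (pure_tensor B C b c)"
    by (simp_all add: associator_def)
qed

lemma associator_iso:
  assumes A: "QSup A" and B: "QSup B" and C: "QSup C"
  shows "is_iso ((A \<otimes> B) \<otimes> C) (A \<otimes> (B \<otimes> C)) (associator A B C)"
proof -
  \<comment> \<open>\<open>ex_trimorphism_lift\<close> extends from tensors bracketed to the left,
    so the inverse is built on \<open>(B \<otimes> C) \<otimes> A\<close> and reached through the
    braiding.\<close>
  have "\<exists>h. h \<in> Mor ((B \<otimes> C) \<otimes> A) ((A \<otimes> B) \<otimes> C) \<and> (\<forall>b\<in>obj B. \<forall>c\<in>obj C. \<forall>a\<in>obj A.
      h (pure_tensor (B \<otimes> C) A (pure_tensor B C b c) a) = pure_tensor (A \<otimes> B) C (pure_tensor A B a b) c)"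
    using A B C
    by (intro ex_trimorphism_lift left_adjoint_pure_left left_adjoint_pure_comp_left
        left_adjoint_pure_comp_right left_adjoint_pure_right) auto
  then obtain h where h: "h \<in> Mor ((B \<otimes> C) \<otimes> A) ((A \<otimes> B) \<otimes> C)"
    and h_pure: "\<And>a b c. a \<in> obj A \<Longrightarrow> b \<in> obj B \<Longrightarrow> c \<in> obj C \<Longrightarrow>
      h (pure_tensor (B \<otimes> C) A (pure_tensor B C b c) a) = pure_tensor (A \<otimes> B) C (pure_tensor A B a b) c"
    by blast
  define k where "k = mcomp (A \<otimes> (B \<otimes> C)) h (braiding A (B \<otimes> C))"
  have k: "k \<in> Mor (A \<otimes> (B \<otimes> C)) ((A \<otimes> B) \<otimes> C)"
    unfolding k_def by (rule Mor_comp[OF braiding_Mor h]) (use A B C in auto)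
  have k_pure: "k (pure_tensor A (B \<otimes> C) a (pure_tensor B C b c)) = pure_tensor (A \<otimes> B) C (pure_tensor A B a b) c"
    if "a \<in> obj A" "b \<in> obj B" "c \<in> obj C" for a b c
    using A B C that by (simp add: k_def compose_eq braiding_pure h_pure)
  have "mcomp ((A \<otimes> B) \<otimes> C) k (associator A B C) = idm ((A \<otimes> B) \<otimes> C)"
    by (rule tensor3_Mor_eqI[OF A B C _ Mor_comp[OF associator_Mor[OF A B C] k] Mor_idm])
      (use A B C in \<open>simp_all add: compose_eq associator_pure k_pure\<close>)
  moreover have "mcomp (A \<otimes> (B \<otimes> C)) (associator A B C) k = idm (A \<otimes> (B \<otimes> C))"
    by (rule tensor3_right_Mor_eqI[OF A B C _ Mor_comp[OF k associator_Mor[OF A B C]] Mor_idm])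
      (use A B C in \<open>simp_all add: compose_eq associator_pure k_pure\<close>)
  ultimately show ?thesis
    by (rule is_isoI[OF associator_Mor[OF A B C] k])
qed

section \<open>The action and the unitors\<close>

lemma
  assumes A: "QSup A" and x: "x \<in> obj A"
  shows act_in_obj [simp]: "act A q x \<in> obj A"
    and hom_act: "y \<in> obj A \<Longrightarrow> hom A (act A q x) y = q \<leadsto> hom A x y"
proof -
  \<comment> \<open>The supremum of \<open>x\<close> with the single weight \<open>q\<close>; its
    hom formula, tested against 1, is the equivalence that defines \<open>act\<close>.\<close>
  obtain z where z: "z \<in> obj A" "\<And>y. y \<in> obj A \<Longrightarrow> hom A z y = q \<leadsto> hom A x y"
    using ex_is_wsup[OF A, of "\<lambda>_. x" "{()}" "\<lambda>_. q"] x by (auto simp: is_wsup_def)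
  have "act A q x = z"
    unfolding act_def
  proof (rule the_equality)
    fix z' assume "z' \<in> obj A \<and> (\<forall>y\<in>obj A. qle A z' y \<longleftrightarrow> q \<le> hom A x y)"
    then have "z' \<in> obj A" "\<And>y. y \<in> obj A \<Longrightarrow> qle A z' y \<longleftrightarrow> qle A z y"
      using z by (auto simp: qle_def)
    then show "z' = z"
      using A z(1) QSup_skeletal[OF A] qcat_refl[OF QSup_qcat[OF A]] unfolding skeletal_def qle_def by blast
  qed (use z in \<open>simp add: qle_def\<close>)
  then show "act A q x \<in> obj A" "y \<in> obj A \<Longrightarrow> hom A (act A q x) y = q \<leadsto> hom A x y"
    using z by auto
qed

text \<open>For \<open>z\<close> representing \<open>hom B (F -) y\<close>, both sides have the hom
  \<open>q \<leadsto> hom A x z\<close> into \<open>y\<close>.\<close>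

lemma left_adjoint_act:
  assumes A: "QSup A" and B: "QSup B" and F: "left_adjoint A B F" and x: "x \<in> obj A"
  shows "F (act A q x) = act B q (F x)"
proof (rule hom_left_eqI[OF QSup_qcat[OF B] QSup_skeletal[OF B]])
  have Fx: "F x \<in> obj B"
    using F x by (rule left_adjoint_in_obj)
  then show "act B q (F x) \<in> obj B"
    using B by simp
  show "F (act A q x) \<in> obj B"
    using F A x by (simp add: left_adjoint_in_obj)
  fix y assume y: "y \<in> obj B"
  then obtain z where "z \<in> obj A" "\<And>x. x \<in> obj A \<Longrightarrow> hom B (F x) y = hom A x z"
    using F A B by (auto simp: left_adjoint_iff representable_def)
  then show "hom B (F (act A q x)) y = hom B (act B q (F x)) y"
    using A B x y Fx by (simp add: hom_act)
qed

lemma act_one [simp]: "QSup A \<Longrightarrow> x \<in> obj A \<Longrightarrow> act A 1 x = x"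
  by (rule hom_left_eqI[of A]) (simp_all add: hom_act)

lemma act_Q: "act Q_cat q p = q * p"
  by (rule hom_left_eqI[OF Q_cat_qcat Q_cat_skeletal])
    (use hom_act[OF Q_cat_QSup, of p] in \<open>simp_all add: residual_residual\<close>)

lemma bimorphism_act:
  assumes A: "QSup A"
  shows "bimorphism Q_cat A A (\<lambda>(q, a). act A q a)"
proof -
  have "representable A (\<lambda>a. hom A (act A q a) y)" if "y \<in> obj A" for q y
    using representable_cong[of A "\<lambda>a. hom A (act A q a) y" "\<lambda>a. q \<leadsto> hom A a y"]
      representable_residual[OF A representable_hom] A that by (simp add: hom_act)
  moreover have "representable Q_cat (\<lambda>q. hom A (act A q a) y)" if "a \<in> obj A" "y \<in> obj A" for a y
    using representable_hom[of "hom A a y" Q_cat] A that by (simp add: hom_act)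
  ultimately show ?thesis
    using A by (simp add: bimorphism_iff)
qed

lemma
  assumes A: "QSup A"
  shows left_unitor_Mor: "left_unitor A \<in> Mor (Q_cat \<otimes> A) A"
    and left_unitor_pure: "a \<in> obj A \<Longrightarrow> left_unitor A (pure_tensor Q_cat A q a) = act A q a"
  using A bimorphism_act[OF A] by (simp_all add: left_unitor_def tensor_lift_Mor tensor_lift_pure)

lemma
  assumes A: "QSup A"
  shows right_unitor_Mor: "right_unitor A \<in> Mor (A \<otimes> Q_cat) A"
    and right_unitor_pure: "a \<in> obj A \<Longrightarrow> right_unitor A (pure_tensor A Q_cat a q) = act A q a"
  using A bimorphism_swap[OF bimorphism_act[OF A]]
  by (simp_all add: right_unitor_def tensor_lift_Mor tensor_lift_pure)

text \<open>Tensoring with \<open>b\<close> is left adjoint, hence preserves the action. Together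
  with \<open>pure_act_right\<close> this is the balancing law: scalars move across the tensor
  sign.\<close>

lemma pure_act_left:
  assumes "QSup A" "QSup B" "a \<in> obj A" "b \<in> obj B"
  shows "pure_tensor A B (act A q a) b = act (A \<otimes> B) q (pure_tensor A B a b)"
  by (rule left_adjoint_act[OF assms(1) tensor_QSup left_adjoint_pure_left]) (use assms in auto)

lemma pure_act_right:
  assumes "QSup A" "QSup B" "a \<in> obj A" "b \<in> obj B"
  shows "pure_tensor A B a (act B q b) = act (A \<otimes> B) q (pure_tensor A B a b)"
  by (rule left_adjoint_act[OF assms(2) tensor_QSup left_adjoint_pure_right]) (use assms in auto)

lemma left_unitor_iso:
  fixes A :: "('a, 'q::comm_unital_quantale) qcat"
  assumes A: "QSup A"
  shows "is_iso (Q_cat \<otimes> A) A (left_unitor A)"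
proof -
  \<comment> \<open>The inverse: tensoring with the unit of the quantale.\<close>
  define k where "k = (\<lambda>a\<in>obj A. pure_tensor Q_cat A 1 a)"
  have k: "k \<in> Mor A (Q_cat \<otimes> A)"
    unfolding k_def using A by (intro restrict_Mor left_adjoint_pure_right) auto
  \<comment> \<open>Moving \<open>q\<close> to the first factor makes it
    \<open>act Q_cat q 1\<close>, which is \<open>q\<close>.\<close>
  have "pure_tensor Q_cat A 1 (act A q a) = pure_tensor Q_cat A q a" if "a \<in> obj A" for q a
    using A that pure_act_left[of Q_cat A 1 a q] by (simp add: pure_act_right act_Q)
  then have "mcomp (Q_cat \<otimes> A) k (left_unitor A) = idm (Q_cat \<otimes> A)"
    by (intro tensor_Mor_eqI[OF Q_cat_QSup A _ Mor_comp[OF left_unitor_Mor[OF A] k] Mor_idm])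
      (use A in \<open>simp_all add: compose_eq left_unitor_pure k_def\<close>)
  moreover have "mcomp A (left_unitor A) k = idm A"
    by (rule Mor_eqI[OF Mor_comp[OF k left_unitor_Mor[OF A]] Mor_idm])
      (use A in \<open>simp_all add: compose_eq left_unitor_pure k_def\<close>)
  ultimately show ?thesis
    by (rule is_isoI[OF left_unitor_Mor[OF A] k])
qed

lemma right_unitor_iso:
  fixes A :: "('a, 'q::comm_unital_quantale) qcat"
  assumes A: "QSup A"
  shows "is_iso (A \<otimes> Q_cat) A (right_unitor A)"
proof -
  define k where "k = (\<lambda>a\<in>obj A. pure_tensor A Q_cat a 1)"
  have k: "k \<in> Mor A (A \<otimes> Q_cat)"
    unfolding k_def using A by (intro restrict_Mor left_adjoint_pure_left) auto
  have "pure_tensor A Q_cat (act A q a) 1 = pure_tensor A Q_cat a q" if "a \<in> obj A" for q a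
    using A that pure_act_right[of A Q_cat a 1 q] by (simp add: pure_act_left act_Q)
  then have "mcomp (A \<otimes> Q_cat) k (right_unitor A) = idm (A \<otimes> Q_cat)"
    by (intro tensor_Mor_eqI[OF A Q_cat_QSup _ Mor_comp[OF right_unitor_Mor[OF A] k] Mor_idm])
      (use A in \<open>simp_all add: compose_eq right_unitor_pure k_def\<close>)
  moreover have "mcomp A (right_unitor A) k = idm A"
    by (rule Mor_eqI[OF Mor_comp[OF k right_unitor_Mor[OF A]] Mor_idm])
      (use A in \<open>simp_all add: compose_eq right_unitor_pure k_def\<close>)
  ultimately show ?thesis
    by (rule is_isoI[OF right_unitor_Mor[OF A] k])
qed

section \<open>Evaluation and currying\<close>

lemma
  assumes A: "QSup A" and B: "QSup B"
  shows evaluation_Mor: "evaluation A B \<in> Mor (internal_hom A B \<otimes> A) B"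
    and evaluation_pure: "F \<in> Mor A B \<Longrightarrow> a \<in> obj A \<Longrightarrow>
      evaluation A B (pure_tensor (internal_hom A B) A F a) = F a"
proof -
  have "bimorphism (internal_hom A B) A B (\<lambda>(F, a). F a)"
    using A B by (simp add: bimorphism_def left_adjoint_eval Mor_left_adjoint)
  then show "evaluation A B \<in> Mor (internal_hom A B \<otimes> A) B"
    and "F \<in> Mor A B \<Longrightarrow> a \<in> obj A \<Longrightarrow> evaluation A B (pure_tensor (internal_hom A B) A F a) = F a"
    using A B by (simp_all add: evaluation_def tensor_lift_Mor tensor_lift_pure)
qed

lemma ex1_curry:
  assumes A: "QSup A" and B: "QSup B" and C: "QSup C" and H: "H \<in> Mor (C \<otimes> A) B"
  shows "\<exists>!K. K \<in> Mor C (internal_hom A B) \<and>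
    mcomp (C \<otimes> A) (evaluation A B) (tensor_map C (internal_hom A B) A A K (idm A)) = H"
proof (rule ex_ex1I)
  \<comment> \<open>On pure tensors the composite recovers \<open>K\<close>, which serves both
    existence and uniqueness.\<close>
  have eval_K: "mcomp (C \<otimes> A) (evaluation A B) (tensor_map C (internal_hom A B) A A K (idm A))
      (pure_tensor C A c a) = K c a"
    if K: "K \<in> Mor C (internal_hom A B)" and c: "c \<in> obj C" and a: "a \<in> obj A" for K c a
    using A B C that Mor_in_obj[OF K c] by (simp add: compose_eq tensor_map_pure evaluation_pure)
  have H': "left_adjoint (C \<otimes> A) B H"
    using H by (rule Mor_left_adjoint)
  define K where "K = (\<lambda>c\<in>obj C. \<lambda>a\<in>obj A. H (pure_tensor C A c a))"
  have K_obj: "K c \<in> Mor A B" if "c \<in> obj C" for c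
    using restrict_Mor[OF left_adjoint_pure_comp_right[OF C A H' that]] that by (simp add: K_def)
  have "representable C (\<lambda>c. INF a\<in>obj A. hom B (K c a) (G a))" if G: "G \<in> Mor A B" for G
  proof -
    \<comment> \<open>The hom from \<open>K c\<close> to \<open>G\<close> is an infimum of
      presheaves representable in \<open>c\<close>; the weight 1 brings it into the form of
      \<open>representable_INF\<close>.\<close>
    have "representable C (\<lambda>c. INF a\<in>obj A. 1 \<leadsto> hom B (H (pure_tensor C A c a)) (G a))"
      using left_adjoint_pure_comp_left[OF C A H'] B C Mor_in_obj[OF G]
      by (intro representable_INF[OF C]) (simp add: left_adjoint_iff)
    then show ?thesis
      using representable_cong[of C "\<lambda>c. INF a\<in>obj A. hom B (K c a) (G a)"
          "\<lambda>c. INF a\<in>obj A. 1 \<leadsto> hom B (H (pure_tensor C A c a)) (G a)"] by (simp add: K_def)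
  qed
  then have "left_adjoint C (internal_hom A B) K"
    using A B C K_obj by (simp add: left_adjoint_iff)
  then have K: "K \<in> Mor C (internal_hom A B)"
    by (simp add: Mor_def K_def)
  moreover have "mcomp (C \<otimes> A) (evaluation A B) (tensor_map C (internal_hom A B) A A K (idm A)) = H"
    by (rule tensor_Mor_eqI[OF C A B Mor_comp[OF tensor_map_Mor evaluation_Mor[OF A B]] H])
      (use A B C K in \<open>simp_all add: eval_K K_def\<close>)
  ultimately show "\<exists>K. K \<in> Mor C (internal_hom A B) \<and>
    mcomp (C \<otimes> A) (evaluation A B) (tensor_map C (internal_hom A B) A A K (idm A)) = H" by blast
  fix K K'
  assume K: "K \<in> Mor C (internal_hom A B) \<and>
      mcomp (C \<otimes> A) (evaluation A B) (tensor_map C (internal_hom A B) A A K (idm A)) = H"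
    and K': "K' \<in> Mor C (internal_hom A B) \<and>
      mcomp (C \<otimes> A) (evaluation A B) (tensor_map C (internal_hom A B) A A K' (idm A)) = H"
  show "K = K'"
  proof (rule Mor_eqI[of K C "internal_hom A B"])
    fix c assume c: "c \<in> obj C"
    then have "K c \<in> Mor A B" "K' c \<in> Mor A B"
      using K K' Mor_in_obj[of _ C "internal_hom A B" c] by auto
    then show "K c = K' c"
      by (rule Mor_eqI) (use K K' c eval_K in metis)
  qed (use K K' in auto)
qed


section \<open>Coherence\<close>

text \<open>Each coherence law equates two morphisms out of an iterated tensor product. These facts
  show that both sides are morphisms, and \<open>structure_pure\<close> computes them on pure
  tensors.\<close>

lemmas structure_Mor =
  Mor_comp tensor_map_Mor associator_Mor left_unitor_Mor right_unitor_Mor braiding_Mor Mor_idm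

lemmas structure_pure =
  compose_eq tensor_map_pure associator_pure left_unitor_pure right_unitor_pure braiding_pure

lemma tensor_map_idm:
  assumes "QSup A" "QSup B"
  shows "tensor_map A A B B (idm A) (idm B) = idm (A \<otimes> B)"
proof (rule tensor_Mor_eqI[of A B "A \<otimes> B"])
  show "tensor_map A A B B (idm A) (idm B) \<in> Mor (A \<otimes> B) (A \<otimes> B)"
    by (rule structure_Mor | simp add: assms)+
qed (use assms in \<open>simp_all add: structure_pure\<close>)

lemma tensor_map_comp:
  assumes QSup: "QSup A" "QSup A1" "QSup A2" "QSup B" "QSup B1" "QSup B2"
    and Mor: "F \<in> Mor A A1" "F1 \<in> Mor A1 A2" "G \<in> Mor B B1" "G1 \<in> Mor B1 B2"
  shows "tensor_map A A2 B B2 (mcomp A F1 F) (mcomp B G1 G) =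
    mcomp (A \<otimes> B) (tensor_map A1 A2 B1 B2 F1 G1) (tensor_map A A1 B B1 F G)"
proof -
  have FG: "mcomp A F1 F \<in> Mor A A2" "mcomp B G1 G \<in> Mor B B2"
    using Mor by (blast intro: Mor_comp)+
  show ?thesis
  proof (rule tensor_Mor_eqI[of A B "A2 \<otimes> B2"])
    show "tensor_map A A2 B B2 (mcomp A F1 F) (mcomp B G1 G) \<in> Mor (A \<otimes> B) (A2 \<otimes> B2)"
      by (rule structure_Mor Mor | simp add: QSup)+
    show "mcomp (A \<otimes> B) (tensor_map A1 A2 B1 B2 F1 G1) (tensor_map A A1 B B1 F G) \<in> Mor (A \<otimes> B) (A2 \<otimes> B2)"
      by (rule structure_Mor Mor | simp add: QSup)+
  qed (use QSup Mor FG in \<open>simp_all add: structure_pure\<close>)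
qed

lemma associator_natural:
  assumes QSup: "QSup A" "QSup A1" "QSup B" "QSup B1" "QSup C" "QSup C1"
    and Mor: "F \<in> Mor A A1" "G \<in> Mor B B1" "H \<in> Mor C C1"
  shows "mcomp ((A \<otimes> B) \<otimes> C) (associator A1 B1 C1)
      (tensor_map (A \<otimes> B) (A1 \<otimes> B1) C C1 (tensor_map A A1 B B1 F G) H) =
    mcomp ((A \<otimes> B) \<otimes> C)
      (tensor_map A A1 (B \<otimes> C) (B1 \<otimes> C1) F (tensor_map B B1 C C1 G H)) (associator A B C)"
    (is "?l = ?r")
proof (rule tensor3_Mor_eqI[of A B C "A1 \<otimes> (B1 \<otimes> C1)"])
  show "?l \<in> Mor ((A \<otimes> B) \<otimes> C) (A1 \<otimes> (B1 \<otimes> C1))"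
    by (rule structure_Mor Mor | simp add: QSup)+
  show "?r \<in> Mor ((A \<otimes> B) \<otimes> C) (A1 \<otimes> (B1 \<otimes> C1))"
    by (rule structure_Mor Mor | simp add: QSup)+
qed (use QSup Mor in \<open>simp_all add: structure_pure tensor_map_Mor\<close>)

text \<open>On the pure tensor of \<open>q\<close> and \<open>a\<close> the law says that
  \<open>F\<close> preserves the action of \<open>q\<close>.\<close>

lemma left_unitor_natural:
  assumes QSup: "QSup A" "QSup A1" and F: "F \<in> Mor A A1"
  shows "mcomp (Q_cat \<otimes> A) (left_unitor A1) (tensor_map Q_cat Q_cat A A1 (idm Q_cat) F) =
    mcomp (Q_cat \<otimes> A) F (left_unitor A)" (is "?l = ?r")
proof (rule tensor_Mor_eqI[of Q_cat A A1])
  show "?l \<in> Mor (Q_cat \<otimes> A) A1"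
    by (rule structure_Mor F | simp add: QSup)+
  show "?r \<in> Mor (Q_cat \<otimes> A) A1"
    by (rule structure_Mor F | simp add: QSup)+
qed (use QSup F in \<open>simp_all add: structure_pure left_adjoint_act[OF _ _ Mor_left_adjoint]\<close>)

lemma right_unitor_natural:
  assumes QSup: "QSup A" "QSup A1" and F: "F \<in> Mor A A1"
  shows "mcomp (A \<otimes> Q_cat) (right_unitor A1) (tensor_map A A1 Q_cat Q_cat F (idm Q_cat)) =
    mcomp (A \<otimes> Q_cat) F (right_unitor A)" (is "?l = ?r")
proof (rule tensor_Mor_eqI[of A Q_cat A1])
  show "?l \<in> Mor (A \<otimes> Q_cat) A1"
    by (rule structure_Mor F | simp add: QSup)+
  show "?r \<in> Mor (A \<otimes> Q_cat) A1"
    by (rule structure_Mor F | simp add: QSup)+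
qed (use QSup F in \<open>simp_all add: structure_pure left_adjoint_act[OF _ _ Mor_left_adjoint]\<close>)

lemma braiding_natural:
  assumes QSup: "QSup A" "QSup A1" "QSup B" "QSup B1" and Mor: "F \<in> Mor A A1" "G \<in> Mor B B1"
  shows "mcomp (A \<otimes> B) (braiding A1 B1) (tensor_map A A1 B B1 F G) =
    mcomp (A \<otimes> B) (tensor_map B B1 A A1 G F) (braiding A B)" (is "?l = ?r")
proof (rule tensor_Mor_eqI[of A B "B1 \<otimes> A1"])
  show "?l \<in> Mor (A \<otimes> B) (B1 \<otimes> A1)"
    by (rule structure_Mor Mor | simp add: QSup)+
  show "?r \<in> Mor (A \<otimes> B) (B1 \<otimes> A1)"
    by (rule structure_Mor Mor | simp add: QSup)+
qed (use QSup Mor in \<open>simp_all add: structure_pure\<close>)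

lemma pentagon:
  assumes QSup: "QSup A" "QSup B" "QSup C" "QSup D"
  shows "mcomp (((A \<otimes> B) \<otimes> C) \<otimes> D) (associator A B (C \<otimes> D)) (associator (A \<otimes> B) C D) =
    mcomp (((A \<otimes> B) \<otimes> C) \<otimes> D)
      (tensor_map A A ((B \<otimes> C) \<otimes> D) (B \<otimes> (C \<otimes> D)) (idm A) (associator B C D))
      (mcomp (((A \<otimes> B) \<otimes> C) \<otimes> D)
         (associator A (B \<otimes> C) D)
         (tensor_map ((A \<otimes> B) \<otimes> C) (A \<otimes> (B \<otimes> C)) D D (associator A B C) (idm D)))"
    (is "?l = ?r")
proof (rule tensor4_Mor_eqI[of A B C D "A \<otimes> (B \<otimes> (C \<otimes> D))"])
  show "?l \<in> Mor (((A \<otimes> B) \<otimes> C) \<otimes> D) (A \<otimes> (B \<otimes> (C \<otimes> D)))"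
    by (rule structure_Mor | simp add: QSup)+
  show "?r \<in> Mor (((A \<otimes> B) \<otimes> C) \<otimes> D) (A \<otimes> (B \<otimes> (C \<otimes> D)))"
    by (rule structure_Mor | simp add: QSup)+
qed (use QSup in \<open>simp_all add: structure_pure associator_Mor\<close>)

text \<open>On the pure tensor of \<open>a\<close>, \<open>q\<close> and \<open>b\<close> the sides
  become \<open>a \<otimes> (q \<cdot> b)\<close> and \<open>(q \<cdot> a) \<otimes> b\<close>,
  which agree by the balancing law.\<close>

lemma triangle:
  assumes QSup: "QSup A" "QSup B"
  shows "mcomp ((A \<otimes> Q_cat) \<otimes> B)
      (tensor_map A A (Q_cat \<otimes> B) B (idm A) (left_unitor B)) (associator A Q_cat B) =
    tensor_map (A \<otimes> Q_cat) A B B (right_unitor A) (idm B)" (is "?l = ?r")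
proof (rule tensor3_Mor_eqI[of A Q_cat B "A \<otimes> B"])
  show "?l \<in> Mor ((A \<otimes> Q_cat) \<otimes> B) (A \<otimes> B)"
    by (rule structure_Mor | simp add: QSup)+
  show "?r \<in> Mor ((A \<otimes> Q_cat) \<otimes> B) (A \<otimes> B)"
    by (rule structure_Mor | simp add: QSup)+
qed (use QSup in \<open>simp_all add: structure_pure left_unitor_Mor right_unitor_Mor pure_act_left pure_act_right\<close>)

lemma hexagon:
  assumes QSup: "QSup A" "QSup B" "QSup C"
  shows "mcomp ((A \<otimes> B) \<otimes> C) (associator B C A)
      (mcomp ((A \<otimes> B) \<otimes> C) (braiding A (B \<otimes> C)) (associator A B C)) =
    mcomp ((A \<otimes> B) \<otimes> C)
      (tensor_map B B (A \<otimes> C) (C \<otimes> A) (idm B) (braiding A C))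
      (mcomp ((A \<otimes> B) \<otimes> C) (associator B A C)
         (tensor_map (A \<otimes> B) (B \<otimes> A) C C (braiding A B) (idm C)))" (is "?l = ?r")
proof (rule tensor3_Mor_eqI[of A B C "B \<otimes> (C \<otimes> A)"])
  show "?l \<in> Mor ((A \<otimes> B) \<otimes> C) (B \<otimes> (C \<otimes> A))"
    by (rule structure_Mor | simp add: QSup)+
  show "?r \<in> Mor ((A \<otimes> B) \<otimes> C) (B \<otimes> (C \<otimes> A))"
    by (rule structure_Mor | simp add: QSup)+
qed (use QSup in \<open>simp_all add: structure_pure braiding_Mor\<close>)

section \<open>Category laws and the closed symmetric monoidal structure\<close>

lemma mcomp_idm_right: "F \<in> Mor A B \<Longrightarrow> mcomp A F (idm A) = F"
  unfolding idm_def using Mor_in_obj by (intro compose_Id[of F "obj A" "obj B"] Mor_extensional) auto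

lemma mcomp_idm_left: "F \<in> Mor A B \<Longrightarrow> mcomp A (idm B) F = F"
  unfolding idm_def using Mor_in_obj by (intro Id_compose[of F "obj A" "obj B"] Mor_extensional) auto

lemma mcomp_assoc: "F \<in> Mor A B \<Longrightarrow> mcomp A H (mcomp A G F) = mcomp A (mcomp B H G) F"
  by (rule compose_assoc[of F]) auto

text \<open>The subcategory is full, so once its objects contain \<open>Q_cat\<close> and are closed
  under \<open>\<otimes>\<close> and \<open>internal_hom\<close>, it inherits structure maps and
  laws from \<open>Q-Sup\<close>.\<close>

theorem corollary5p13:
  fixes A :: "('a, 'q::comm_unital_quantale) qcat"
    and A1 :: "('a1, 'q) qcat" and A2 :: "('a2, 'q) qcat"
    and B :: "('b, 'q) qcat" and B1 :: "('b1, 'q) qcat" and B2 :: "('b2, 'q) qcat"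
    and C :: "('c, 'q) qcat" and C1 :: "('c1, 'q) qcat"
    and D :: "('d, 'q) qcat"
  shows
    (* the tensor product represents bimorphisms *)
    "(QSup A \<and> QSup B \<longrightarrow>
        QSup (A \<otimes> B) \<and> bimorphism A B (A \<otimes> B) (\<lambda>(a, b). pure_tensor A B a b)) \<and>
     (QSup A \<and> QSup B \<and> QSup C \<longrightarrow>
        (\<forall>f. bimorphism A B C f \<longrightarrow>
           (\<exists>!h. h \<in> Mor (A \<otimes> B) C \<and>
                 (\<forall>a\<in>obj A. \<forall>b\<in>obj B. h (pure_tensor A B a b) = f (a, b))))) \<and>
     \<comment> \<open>closure of the ccd objects under tensor product, internal hom and unit\<close>
     (QSup_ccd A \<and> QSup_ccd B \<longrightarrow> QSup_ccd (A \<otimes> B)) \<and>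
     (QSup_ccd A \<and> QSup_ccd B \<longrightarrow> QSup_ccd (internal_hom A B)) \<and>
     QSup_ccd (Q_cat :: ('q, 'q) qcat) \<and>
     \<comment> \<open>category\<close>
     (QSup_ccd A \<longrightarrow> idm A \<in> Mor A A) \<and>
     (QSup_ccd A \<and> QSup_ccd B \<and> QSup_ccd C \<longrightarrow>
        (\<forall>F\<in>Mor A B. \<forall>G\<in>Mor B C. mcomp A G F \<in> Mor A C)) \<and>
     (QSup_ccd A \<and> QSup_ccd B \<longrightarrow>
        (\<forall>F\<in>Mor A B. mcomp A F (idm A) = F \<and> mcomp A (idm B) F = F)) \<and>
     (QSup_ccd A \<and> QSup_ccd B \<and> QSup_ccd C \<and> QSup_ccd D \<longrightarrow>
        (\<forall>F\<in>Mor A B. \<forall>G\<in>Mor B C. \<forall>H\<in>Mor C D.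
           mcomp A H (mcomp A G F) = mcomp A (mcomp B H G) F)) \<and>
     \<comment> \<open>the tensor product is a bifunctor\<close>
     (QSup_ccd A \<and> QSup_ccd A1 \<and> QSup_ccd B \<and> QSup_ccd B1 \<longrightarrow>
        (\<forall>F\<in>Mor A A1. \<forall>G\<in>Mor B B1. tensor_map A A1 B B1 F G \<in> Mor (A \<otimes> B) (A1 \<otimes> B1))) \<and>
     (QSup_ccd A \<and> QSup_ccd B \<longrightarrow> tensor_map A A B B (idm A) (idm B) = idm (A \<otimes> B)) \<and>
     (QSup_ccd A \<and> QSup_ccd A1 \<and> QSup_ccd A2 \<and> QSup_ccd B \<and> QSup_ccd B1 \<and> QSup_ccd B2 \<longrightarrow>
        (\<forall>F\<in>Mor A A1. \<forall>F1\<in>Mor A1 A2. \<forall>G\<in>Mor B B1. \<forall>G1\<in>Mor B1 B2.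
           tensor_map A A2 B B2 (mcomp A F1 F) (mcomp B G1 G) =
           mcomp (A \<otimes> B) (tensor_map A1 A2 B1 B2 F1 G1) (tensor_map A A1 B B1 F G))) \<and>
     \<comment> \<open>associator, unitors and braiding are isomorphisms\<close>
     (QSup_ccd A \<and> QSup_ccd B \<and> QSup_ccd C \<longrightarrow>
        is_iso ((A \<otimes> B) \<otimes> C) (A \<otimes> (B \<otimes> C)) (associator A B C)) \<and>
     (QSup_ccd A \<longrightarrow> is_iso (Q_cat \<otimes> A) A (left_unitor A)) \<and>
     (QSup_ccd A \<longrightarrow> is_iso (A \<otimes> Q_cat) A (right_unitor A)) \<and>
     (QSup_ccd A \<and> QSup_ccd B \<longrightarrow> is_iso (A \<otimes> B) (B \<otimes> A) (braiding A B)) \<and>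
     \<comment> \<open>their naturality\<close>
     (QSup_ccd A \<and> QSup_ccd A1 \<and> QSup_ccd B \<and> QSup_ccd B1 \<and> QSup_ccd C \<and> QSup_ccd C1 \<longrightarrow>
        (\<forall>F\<in>Mor A A1. \<forall>G\<in>Mor B B1. \<forall>H\<in>Mor C C1.
           mcomp ((A \<otimes> B) \<otimes> C) (associator A1 B1 C1)
             (tensor_map (A \<otimes> B) (A1 \<otimes> B1) C C1 (tensor_map A A1 B B1 F G) H) =
           mcomp ((A \<otimes> B) \<otimes> C)
             (tensor_map A A1 (B \<otimes> C) (B1 \<otimes> C1) F (tensor_map B B1 C C1 G H))
             (associator A B C))) \<and>
     (QSup_ccd A \<and> QSup_ccd A1 \<longrightarrow>
        (\<forall>F\<in>Mor A A1.
           mcomp (Q_cat \<otimes> A) (left_unitor A1) (tensor_map Q_cat Q_cat A A1 (idm Q_cat) F) =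
           mcomp (Q_cat \<otimes> A) F (left_unitor A))) \<and>
     (QSup_ccd A \<and> QSup_ccd A1 \<longrightarrow>
        (\<forall>F\<in>Mor A A1.
           mcomp (A \<otimes> Q_cat) (right_unitor A1) (tensor_map A A1 Q_cat Q_cat F (idm Q_cat)) =
           mcomp (A \<otimes> Q_cat) F (right_unitor A))) \<and>
     (QSup_ccd A \<and> QSup_ccd A1 \<and> QSup_ccd B \<and> QSup_ccd B1 \<longrightarrow>
        (\<forall>F\<in>Mor A A1. \<forall>G\<in>Mor B B1.
           mcomp (A \<otimes> B) (braiding A1 B1) (tensor_map A A1 B B1 F G) =
           mcomp (A \<otimes> B) (tensor_map B B1 A A1 G F) (braiding A B))) \<and>
     \<comment> \<open>pentagon, triangle, hexagon, symmetry\<close>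
     (QSup_ccd A \<and> QSup_ccd B \<and> QSup_ccd C \<and> QSup_ccd D \<longrightarrow>
        mcomp (((A \<otimes> B) \<otimes> C) \<otimes> D) (associator A B (C \<otimes> D)) (associator (A \<otimes> B) C D) =
        mcomp (((A \<otimes> B) \<otimes> C) \<otimes> D)
          (tensor_map A A ((B \<otimes> C) \<otimes> D) (B \<otimes> (C \<otimes> D)) (idm A) (associator B C D))
          (mcomp (((A \<otimes> B) \<otimes> C) \<otimes> D)
             (associator A (B \<otimes> C) D)
             (tensor_map ((A \<otimes> B) \<otimes> C) (A \<otimes> (B \<otimes> C)) D D (associator A B C) (idm D)))) \<and>
     (QSup_ccd A \<and> QSup_ccd B \<longrightarrow>
        mcomp ((A \<otimes> Q_cat) \<otimes> B)
          (tensor_map A A (Q_cat \<otimes> B) B (idm A) (left_unitor B)) (associator A Q_cat B) =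
        tensor_map (A \<otimes> Q_cat) A B B (right_unitor A) (idm B)) \<and>
     (QSup_ccd A \<and> QSup_ccd B \<and> QSup_ccd C \<longrightarrow>
        mcomp ((A \<otimes> B) \<otimes> C) (associator B C A)
          (mcomp ((A \<otimes> B) \<otimes> C) (braiding A (B \<otimes> C)) (associator A B C)) =
        mcomp ((A \<otimes> B) \<otimes> C)
          (tensor_map B B (A \<otimes> C) (C \<otimes> A) (idm B) (braiding A C))
          (mcomp ((A \<otimes> B) \<otimes> C) (associator B A C)
             (tensor_map (A \<otimes> B) (B \<otimes> A) C C (braiding A B) (idm C)))) \<and>
     (QSup_ccd A \<and> QSup_ccd B \<longrightarrow>
        mcomp (A \<otimes> B) (braiding B A) (braiding A B) = idm (A \<otimes> B)) \<and>
     \<comment> \<open>closedness: the internal hom is right adjoint to tensoring, with counit evaluation\<close>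
     (QSup_ccd A \<and> QSup_ccd B \<longrightarrow> evaluation A B \<in> Mor (internal_hom A B \<otimes> A) B) \<and>
     (QSup_ccd A \<and> QSup_ccd B \<and> QSup_ccd C \<longrightarrow>
        (\<forall>H\<in>Mor (C \<otimes> A) B.
           \<exists>!K. K \<in> Mor C (internal_hom A B) \<and>
             mcomp (C \<otimes> A) (evaluation A B)
               (tensor_map C (internal_hom A B) A A K (idm A)) = H))"
  by (intro conjI impI ballI allI; (elim conjE)?;
      (rule tensor_QSup bimorphism_pure ex1_tensor_lift tensor_ccd internal_hom_ccd Q_cat_ccd Mor_idm
        mcomp_idm_right mcomp_idm_left mcomp_assoc Mor_comp tensor_map_Mor tensor_map_idm tensor_map_comp
        associator_iso left_unitor_iso right_unitor_iso braiding_iso associator_natural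
        left_unitor_natural right_unitor_natural braiding_natural pentagon triangle hexagon
        braiding_braiding evaluation_Mor ex1_curry; (assumption | simp)))

end
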